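(* Let $\nu\in\mathbb{C}$, and let $(b_m)_{m\ge 0}$ and $(a_n^{\nu})_{n\ge 0}$ be sequences of complex numbers. Suppose that $$f(z)=\sum_{m=0}^{\infty} b_m z^m$$ and $$z^{\nu}f(z)=\sum_{n=0}^{\infty} a_n^{\nu}\,\mathrm{J}_{\nu+n}\left[(\nu+n)z\right],$$ where both series converge absolutely for $z$ in some domain $\Omega\subseteq\mathbb{C}$. For integers $n,k$ with $0\le k\le \lfloor n/2\rfloor$ put $$u_{n,k}=\frac{(-1)^k}{k!\,\Gamma(\nu+n-k+1)}\left(\frac{\nu+n-2k}{2}\right)^{\nu+n}$$ and $$v_{n,k}=\frac12\,\frac{(\nu+n-2k)^2\,\Gamma(\nu+n-k)}{k!}\left(\frac{2}{\nu+n}\right)^{\nu+n-2k+1}.$$ Then, for all values of $\nu$ and every integer $s\ge 0$, $$a_s^{\nu}=\sum_{m=0}^{\lfloor s/2\rfloor} v_{s,m}\,b_{s-2m}$$ and $$b_s=\sum_{m=0}^{\lfloor s/2\rfloor} u_{s,m}\,a_{s-2m}^{\nu}.$$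
   Context: For $\nu\in\mathbb{C}$ the Bessel function of the first kind is $$\mathrm{J}_{\nu}(z)=\sum_{n=0}^{\infty}\frac{(-1)^n}{n!\,\Gamma(\nu+n+1)}\left(\frac z2\right)^{\nu+2n},$$ where $\Gamma$ is the Gamma function and $1/\Gamma$ is taken to be $0$ at the poles of $\Gamma$. Conventions for formulas: $0^0=1$. Complex powers are taken with consistent branches, so that $\left[\frac{(\nu+n)z}{2}\right]^{\nu+n+2m}=\left(\frac{\nu+n}{2}\right)^{\nu+n+2m}z^{\nu+n+2m}$, $z^{\nu+j}=z^{\nu}z^{j}$ for integers $j$, and $(2/w)^{c}=(w/2)^{-c}$. Each of the asserted identities is understood for those values of $\nu$ (and $s$) for which the expressions occurring in it are defined (for example, $v_{0,0}$ is not defined by the formula when $\nu=0$). *)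

theory Defs
  imports "HOL-Analysis.Analysis"
begin

text \<open>
  Complex powers are formed with a logarithm \<open>L\<close>, i.e. any function satisfying
  \<open>exp (L w) = w\<close> for all \<open>w \<noteq> 0\<close>; it need not be continuous or principal.
  The library's \<open>powr\<close> is not used because it gives \<open>0 powr 0 = 0\<close>, whereas
  here \<open>0\<^sup>0 = 1\<close>, and because it fixes the principal branch.
\<close>

definition is_log :: "(complex \<Rightarrow> complex) \<Rightarrow> bool" where
  "is_log L \<longleftrightarrow> (\<forall>w. w \<noteq> 0 \<longrightarrow> exp (L w) = w)"

definition cpow :: "(complex \<Rightarrow> complex) \<Rightarrow> complex \<Rightarrow> complex \<Rightarrow> complex" where
  "cpow L w c = (if w = 0 then (if c = 0 then 1 else 0) else exp (c * L w))"

text \<open>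
  The series of the Bessel function of the first kind of order \<open>\<nu>\<close>, where \<open>P c\<close> is the
  value used for the power \<open>(z/2)\<^sup>c\<close>.  The entire function \<open>rGamma\<close> is \<open>1/\<Gamma>\<close>, with
  value 0 at the poles of \<open>\<Gamma>\<close>.
\<close>

definition bessel_J_series :: "(complex \<Rightarrow> complex) \<Rightarrow> complex \<Rightarrow> complex" where
  "bessel_J_series P \<nu> =
     (\<Sum>n. (-1) ^ n / fact n * rGamma (\<nu> + of_nat n + 1) * P (\<nu> + 2 * of_nat n))"

definition bessel_J :: "(complex \<Rightarrow> complex) \<Rightarrow> complex \<Rightarrow> complex \<Rightarrow> complex" where
  "bessel_J L \<nu> z = bessel_J_series (cpow L (z / 2)) \<nu>"

text \<open>
  \<open>bessel_J_prod L \<nu> c z\<close> is \<open>J\<^sub>\<nu>(c z)\<close> on the branch given by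
  \<open>(c z / 2)\<^sup>e = (c / 2)\<^sup>e z\<^sup>e\<close>, a law that a single-valued logarithm cannot satisfy for
  all \<open>c\<close> and \<open>z\<close>.
\<close>

definition bessel_J_prod ::
  "(complex \<Rightarrow> complex) \<Rightarrow> complex \<Rightarrow> complex \<Rightarrow> complex \<Rightarrow> complex" where
  "bessel_J_prod L \<nu> c z = bessel_J_series (\<lambda>e. cpow L (c / 2) e * cpow L z e) \<nu>"

definition kapteyn_u :: "(complex \<Rightarrow> complex) \<Rightarrow> complex \<Rightarrow> nat \<Rightarrow> nat \<Rightarrow> complex" where
  "kapteyn_u L \<nu> n k =
     (-1) ^ k / fact k * rGamma (\<nu> + of_nat n - of_nat k + 1)
       * cpow L ((\<nu> + of_nat n - 2 * of_nat k) / 2) (\<nu> + of_nat n)"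

text \<open>
  In \<open>kapteyn_v\<close> the power \<open>(2/w)\<^sup>c\<close> is read as \<open>(w/2)\<^bsup>-c\<^esup>\<close>.  The formula is meaningful
  exactly when \<open>\<nu> + n - k\<close> is not a pole of \<open>\<Gamma>\<close> and \<open>\<nu> + n \<noteq> 0\<close>.
\<close>

definition kapteyn_v :: "(complex \<Rightarrow> complex) \<Rightarrow> complex \<Rightarrow> nat \<Rightarrow> nat \<Rightarrow> complex" where
  "kapteyn_v L \<nu> n k =
     1 / 2 * ((\<nu> + of_nat n - 2 * of_nat k) ^ 2 * Gamma (\<nu> + of_nat n - of_nat k) / fact k)
       * cpow L ((\<nu> + of_nat n) / 2) (- (\<nu> + of_nat n - 2 * of_nat k + 1))"

definition kapteyn_v_defined :: "complex \<Rightarrow> nat \<Rightarrow> nat \<Rightarrow> bool" where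
  "kapteyn_v_defined \<nu> n k \<longleftrightarrow>
     \<nu> + of_nat n - of_nat k \<notin> \<int>\<^sub>\<le>\<^sub>0 \<and> \<nu> + of_nat n \<noteq> 0"

lemma is_log_Ln: "is_log Ln"
  by (simp add: is_log_def)

lemma cpow_Ln: "w \<noteq> 0 \<Longrightarrow> cpow Ln w c = w powr c"
  by (simp add: cpow_def powr_def)

lemma cpow_add_of_nat:
  assumes "is_log L" "z \<noteq> 0"
  shows "cpow L z (c + of_nat j) = cpow L z c * z ^ j"
  using assms
  by (simp add: cpow_def is_log_def distrib_right exp_add exp_of_nat_mult)

lemma bessel_J_prod_eq:
  assumes "c \<noteq> 0" "z \<noteq> 0" "L (c * z / 2) = L (c / 2) + L z"
  shows "bessel_J_prod L \<nu> c z = bessel_J L \<nu> (c * z)"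
  using assms
  by (simp add: bessel_J_prod_def bessel_J_def bessel_J_series_def cpow_def
      distrib_left exp_add)

lemma bessel_J_prod_Ln:
  assumes "r > 0" "z \<noteq> 0"
  shows "bessel_J_prod Ln \<nu> (of_real r) z = bessel_J Ln \<nu> (of_real r * z)"
proof (rule bessel_J_prod_eq)
  show "Ln (of_real r * z / 2) = Ln (of_real r / 2) + Ln z"
    using assms Ln_times_of_real[of "r / 2" z] Ln_of_real[of "r / 2"] by simp
qed (use assms in auto)

end

theory Submission
  imports Defs "HOL-Complex_Analysis.Complex_Analysis"
begin

text \<open>
  Comparing coefficients would be immediate if the Kapteyn series converged near \<open>0\<close>, but \<open>\<Omega>\<close> may
  lie far away from \<open>0\<close>.  Write \<open>J\<^sub>\<mu>(\<mu> z) = c\<^sub>\<mu> z\<^sup>\<nu> g\<^sub>n(z)\<close> with \<open>\<mu> = \<nu> + n\<close> and \<open>g\<^sub>n\<close> entire.  With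
  \<open>D = z d/dz\<close> Bessel's equation becomes \<open>(D + \<nu>)\<^sup>2 g = \<mu>\<^sup>2 (1 - z\<^sup>2) g\<close>, so along a ray through
  a nonreal point the logarithmic derivative of \<open>g\<^sub>n\<close> stays within \<open>O(1)\<close> of \<open>\<mu> sqrt(1 - z\<^sup>2)\<close>,
  whose real part is at least of order \<open>n\<close>; hence \<open>\<bar>g\<^sub>n(t w)\<bar> \<le> t\<^bsup>\<kappa> n\<^esup> \<bar>g\<^sub>n(w)\<bar>\<close> for \<open>0 < t \<le> 1\<close>
  and large \<open>n\<close>.  By Baire's theorem the terms of the series are uniformly bounded on a small disc in \<open>\<Omega>\<close>,
  so the series converges locally uniformly on the sector between this disc and \<open>0\<close>, and it
  still represents \<open>f\<close> there.  As \<open>t \<rightarrow> 0\<close> the tail from \<open>N\<close> on is \<open>O(t\<^bsup>\<kappa> N\<^esup>)\<close>, which determines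
  the coefficients of \<open>f\<close>.  The formula for \<open>a\<^sub>s\<close> is the inverse of that for \<open>b\<^sub>s\<close>; the
  orthogonality sums telescope.
\<close>

subsection \<open>Growth of solutions of a singular linear system\<close>

text \<open>\<open>X\<close> is the growing mode and \<open>Y\<close> the decaying one, coupled by 1
  and \<open>d\<close>. Since \<open>\<delta> / C + C \<le> 2 * \<rho>\<close>, the rates dominate
  the coupling and |Y|^2 - C^2 |X|^2 never increases. It starts at 0, so the solution stays in the
  cone.\<close>

lemma ode_cone_bound:
  fixes X Y p q d :: "real \<Rightarrow> complex"
  assumes cont: "continuous_on {0..1} X" "continuous_on {0..1} Y"
    and init: "X 0 = 0" "Y 0 = 0"
    and derX: "\<And>t. 0 < t \<Longrightarrow> t < 1 \<Longrightarrow>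
      (X has_vector_derivative (p t * X t + Y t) /\<^sub>R t) (at t)"
    and derY: "\<And>t. 0 < t \<Longrightarrow> t < 1 \<Longrightarrow>
      (Y has_vector_derivative (- q t * Y t - d t * X t) /\<^sub>R t) (at t)"
    and p: "\<And>t. 0 < t \<Longrightarrow> t < 1 \<Longrightarrow> \<rho> \<le> Re (p t)"
    and q: "\<And>t. 0 < t \<Longrightarrow> t < 1 \<Longrightarrow> \<rho> \<le> Re (q t)"
    and d: "\<And>t. 0 < t \<Longrightarrow> t < 1 \<Longrightarrow> norm (d t) \<le> \<delta>"
    and C: "C > 0" "\<delta> / C + C \<le> 2 * \<rho>"
    and t: "0 \<le> t" "t \<le> 1"
  shows "norm (Y t) \<le> C * norm (X t)"
proof -
  define \<phi> where "\<phi> = (\<lambda>t. Y t \<bullet> Y t - C\<^sup>2 * (X t \<bullet> X t))"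
  have "\<phi> t \<le> \<phi> 0"
  proof (rule DERIV_nonpos_imp_decreasing_open[OF t(1)])
    show "continuous_on {0..t} \<phi>" unfolding \<phi>_def
      by (intro continuous_intros continuous_on_subset[OF cont(1)] continuous_on_subset[OF cont(2)])
         (use t in auto)
    fix u assume u: "0 < u" "u < t"
    then have u': "0 < u" "u < 1" using t by auto
    define X' where "X' = (p u * X u + Y u) /\<^sub>R u"
    define Y' where "Y' = (- q u * Y u - d u * X u) /\<^sub>R u"
    have dX: "(X has_derivative (\<lambda>h. h *\<^sub>R X')) (at u)"
      using derX[OF u'] by (simp add: has_vector_derivative_def X'_def)
    have dY: "(Y has_derivative (\<lambda>h. h *\<^sub>R Y')) (at u)"
      using derY[OF u'] by (simp add: has_vector_derivative_def Y'_def)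
    have D: "DERIV \<phi> u :> 2 * (Y u \<bullet> Y') - C\<^sup>2 * (2 * (X u \<bullet> X'))"
      unfolding \<phi>_def has_field_derivative_def
      by (rule derivative_eq_intros dX dY refl | simp add: fun_eq_iff inner_commute algebra_simps)+
    let ?x = "norm (X u)" and ?y = "norm (Y u)"
    have mul: "v \<bullet> (w * v) = Re w * (norm v)\<^sup>2" for v w :: complex
      by (simp add: inner_complex_def cmod_def algebra_simps power2_eq_square)
    have i1: "Y u \<bullet> (u *\<^sub>R Y') \<le> - \<rho> * ?y\<^sup>2 + \<delta> * ?x * ?y"
    proof -
      have "Y u \<bullet> (u *\<^sub>R Y') = - (Y u \<bullet> (q u * Y u)) - Y u \<bullet> (d u * X u)"
        using u' by (simp add: Y'_def inner_diff_right)
      also have "\<dots> = - Re (q u) * ?y\<^sup>2 - Y u \<bullet> (d u * X u)" by (simp add: mul)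
      also have "\<dots> \<le> - \<rho> * ?y\<^sup>2 + norm (Y u) * norm (d u * X u)"
        using mult_right_mono[OF q[OF u'], of "?y\<^sup>2"] Cauchy_Schwarz_ineq2[of "Y u" "d u * X u"]
        by (simp add: abs_le_iff)
      also have "norm (Y u) * norm (d u * X u) \<le> \<delta> * ?x * ?y"
        using mult_right_mono[OF d[OF u'], of "?x * ?y"] by (simp add: norm_mult mult_ac)
      finally show ?thesis by simp
    qed
    have i2: "X u \<bullet> (u *\<^sub>R X') \<ge> \<rho> * ?x\<^sup>2 - ?x * ?y"
    proof -
      have "X u \<bullet> (u *\<^sub>R X') = X u \<bullet> (p u * X u) + X u \<bullet> Y u"
        using u' by (simp add: X'_def inner_add_right)
      then show ?thesis
        using mult_right_mono[OF p[OF u'], of "?x\<^sup>2"] Cauchy_Schwarz_ineq2[of "X u" "Y u"]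
        by (simp add: mul abs_le_iff)
    qed
    \<comment> \<open>Multiplying by u removes the singular factor 1/u and leaves a quadratic form
      in \<open>?x\<close> and \<open>?y\<close>.\<close>
    have "u * (2 * (Y u \<bullet> Y') - C\<^sup>2 * (2 * (X u \<bullet> X')))
        = 2 * (Y u \<bullet> (u *\<^sub>R Y')) - 2 * C\<^sup>2 * (X u \<bullet> (u *\<^sub>R X'))"
      by (simp add: algebra_simps)
    also have "\<dots> \<le> 2 * (- \<rho> * ?y\<^sup>2 + \<delta> * ?x * ?y) - 2 * C\<^sup>2 * (\<rho> * ?x\<^sup>2 - ?x * ?y)"
      using i1 mult_left_mono[OF i2, of "2 * C\<^sup>2"] by simp
    also have "\<dots> = (\<delta> / C + C) * (2 * (C * ?x) * ?y) - 2 * \<rho> * (?y\<^sup>2 + (C * ?x)\<^sup>2)"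
      using C by (simp add: field_simps power2_eq_square)
    also have "\<dots> \<le> 0"
    proof -
      have \<delta>: "\<delta> \<ge> 0" using d[OF u'] norm_ge_zero[of "d u"] by linarith
      have "(\<delta> / C + C) * (2 * (C * ?x) * ?y) \<le> (\<delta> / C + C) * (?y\<^sup>2 + (C * ?x)\<^sup>2)"
        using C \<delta> sum_squares_bound[of "C * ?x" ?y] by (intro mult_left_mono) auto
      also have "\<dots> \<le> 2 * \<rho> * (?y\<^sup>2 + (C * ?x)\<^sup>2)"
        using C by (intro mult_right_mono) auto
      finally show ?thesis by simp
    qed
    finally have "2 * (Y u \<bullet> Y') - C\<^sup>2 * (2 * (X u \<bullet> X')) \<le> 0"
      using u' by (simp add: mult_le_0_iff)
    with D show "\<exists>y. DERIV \<phi> u :> y \<and> y \<le> 0" by blast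
  qed
  then have "(norm (Y t))\<^sup>2 \<le> (C * norm (X t))\<^sup>2"
    by (simp add: \<phi>_def init power2_norm_eq_inner power_mult_distrib)
  then show ?thesis
    using C(1) by (simp add: abs_le_square_iff[symmetric] abs_mult)
qed

text \<open>Inside the cone, t d/dt |X|^2 \<ge> 2 (\<rho> - C) |X|^2 \<ge> 2 \<kappa> |X|^2. Hence
  |X|^2 t^(-2 \<kappa>) is nondecreasing, and its values at t and 1 are compared.\<close>

lemma ode_growth_bound:
  fixes X Y p :: "real \<Rightarrow> complex"
  assumes cont: "continuous_on {0..1} X"
    and derX: "\<And>t. 0 < t \<Longrightarrow> t < 1 \<Longrightarrow>
      (X has_vector_derivative (p t * X t + Y t) /\<^sub>R t) (at t)"
    and p: "\<And>t. 0 < t \<Longrightarrow> t < 1 \<Longrightarrow> \<rho> \<le> Re (p t)"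
    and Y: "\<And>t. 0 < t \<Longrightarrow> t < 1 \<Longrightarrow> norm (Y t) \<le> C * norm (X t)"
    and k: "\<kappa> \<le> \<rho> - C"
    and t: "0 < t" "t \<le> 1"
  shows "norm (X t) \<le> t powr \<kappa> * norm (X 1)"
proof -
  define \<psi> where "\<psi> = (\<lambda>t. (X t \<bullet> X t) * t powr (-2 * \<kappa>))"
  have "\<psi> t \<le> \<psi> 1"
  proof (rule DERIV_nonneg_imp_increasing_open[OF t(2)])
    show "continuous_on {t..1} \<psi>" unfolding \<psi>_def
      by (intro continuous_intros continuous_on_subset[OF cont]) (use t in auto)
    fix u assume u: "t < u" "u < 1"
    then have u': "0 < u" "u < 1" using t by auto
    define X' where "X' = (p u * X u + Y u) /\<^sub>R u"
    have dX: "(X has_derivative (\<lambda>h. h *\<^sub>R X')) (at u)"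
      using derX[OF u'] by (simp add: has_vector_derivative_def X'_def)
    have dX2: "((\<lambda>t. X t \<bullet> X t) has_field_derivative 2 * (X u \<bullet> X')) (at u)"
      unfolding has_field_derivative_def
      by (rule derivative_eq_intros dX refl | simp add: fun_eq_iff inner_commute algebra_simps)+
    have dpow: "((\<lambda>t. t powr (-2 * \<kappa>)) has_field_derivative
        (-2 * \<kappa>) * u powr (-2 * \<kappa> - 1)) (at u)"
      by (rule has_real_derivative_powr[OF u'(1)])
    have D: "DERIV \<psi> u :> 2 * (X u \<bullet> X') * u powr (-2 * \<kappa>)
        + (-2 * \<kappa>) * u powr (-2 * \<kappa> - 1) * (X u \<bullet> X u)"
      unfolding \<psi>_def by (rule DERIV_mult'[OF dX2 dpow, THEN DERIV_cong]) (simp add: algebra_simps)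
    let ?x = "norm (X u)"
    have "X u \<bullet> (u *\<^sub>R X') = X u \<bullet> (p u * X u) + X u \<bullet> Y u"
      using u' by (simp add: X'_def inner_add_right)
    moreover have "X u \<bullet> (p u * X u) = Re (p u) * ?x\<^sup>2"
      by (simp add: inner_complex_def cmod_def algebra_simps power2_eq_square)
    moreover have "- (C * ?x\<^sup>2) \<le> X u \<bullet> Y u"
      using Cauchy_Schwarz_ineq2[of "X u" "Y u"] mult_left_mono[OF Y[OF u'], of ?x]
      by (simp add: abs_le_iff power2_eq_square mult_ac)
    ultimately have "u * (X u \<bullet> X') \<ge> (\<rho> - C) * ?x\<^sup>2"
      using mult_right_mono[OF p[OF u'], of "?x\<^sup>2"] by (simp add: algebra_simps)
    moreover have "(\<rho> - C) * ?x\<^sup>2 \<ge> \<kappa> * ?x\<^sup>2" using k by (intro mult_right_mono) auto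
    ultimately have "u * (X u \<bullet> X') - \<kappa> * (X u \<bullet> X u) \<ge> 0"
      by (simp add: power2_norm_eq_inner)
    then have "2 * u powr (-2 * \<kappa> - 1) * (u * (X u \<bullet> X') - \<kappa> * (X u \<bullet> X u)) \<ge> 0" by simp
    also have "2 * u powr (-2 * \<kappa> - 1) * (u * (X u \<bullet> X') - \<kappa> * (X u \<bullet> X u))
      = 2 * (X u \<bullet> X') * u powr (-2 * \<kappa>) + (-2 * \<kappa>) * u powr (-2 * \<kappa> - 1) * (X u \<bullet> X u)"
      using u' by (simp add: powr_diff field_simps)
    finally show "\<exists>y. DERIV \<psi> u :> y \<and> y \<ge> 0" using D by blast
  qed
  then have "(norm (X t))\<^sup>2 * t powr (-2 * \<kappa>) \<le> (norm (X 1))\<^sup>2"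
    by (simp add: \<psi>_def power2_norm_eq_inner)
  moreover have "t powr (-2 * \<kappa>) = inverse ((t powr \<kappa>)\<^sup>2)"
    using t by (simp add: powr_minus power2_eq_square powr_add[symmetric])
  ultimately have "(norm (X t))\<^sup>2 \<le> (t powr \<kappa> * norm (X 1))\<^sup>2"
    using t by (simp add: divide_inverse[symmetric] pos_divide_le_eq power_mult_distrib mult.commute
        del: inverse_eq_divide)
  then show ?thesis
    by (rule power2_le_imp_le) simp
qed

subsection \<open>The Bessel terms as entire functions\<close>

text \<open>This is 0F1(; \<mu> + 1; x) / \<Gamma>(\<mu> + 1), and J_\<mu>(y) is (y/2)^\<mu> times
  its value at x = -(y/2)^2. Dividing by the Gamma function keeps it entire in x for every \<mu>,
  negative integers included.\<close>

definition hyper01 :: "complex \<Rightarrow> complex \<Rightarrow> complex" where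
  "hyper01 \<mu> x = (\<Sum>k. rGamma (\<mu> + of_nat k + 1) / fact k * x ^ k)"

lemma summable_hyper01:
  "summable (\<lambda>k. rGamma (\<mu> + of_nat k + 1) / fact k * x ^ k)" for \<mu> x :: complex
proof -
  obtain N where N: "real N \<ge> norm \<mu> + 2 * norm x"
    using real_arch_simple by blast
  show ?thesis
  proof (rule summable_ratio_test[where c = "1/2" and N = N])
    fix k assume k: "k \<ge> N"
    let ?c = "\<lambda>k. rGamma (\<mu> + of_nat k + 1) / fact k"
    have "(\<mu> + of_nat k + 1) * rGamma (\<mu> + of_nat (Suc k) + 1) = rGamma (\<mu> + of_nat k + 1)"
      using rGamma_plus1[of "\<mu> + of_nat k + 1"] by (simp add: add_ac)
    \<comment> \<open>Coefficients may vanish at poles of \<Gamma>, so their ratio is kept in this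
      product form.\<close>
    then have rec: "?c k = of_nat (Suc k) * (\<mu> + of_nat k + 1) * ?c (Suc k)"
      by (simp del: of_nat_Suc)
    have "norm (\<mu> + of_nat k + 1) \<ge> norm (of_nat (Suc k) :: complex) - norm \<mu>"
      by (metis add.assoc add.commute norm_diff_ineq of_nat_Suc)
    then have "2 * norm x \<le> norm (\<mu> + of_nat k + 1)"
      using N k by (simp del: of_nat_Suc)
    also have "\<dots> \<le> norm (of_nat (Suc k) :: complex) * norm (\<mu> + of_nat k + 1)"
      using mult_right_mono[of 1 "norm (of_nat (Suc k) :: complex)" "norm (\<mu> + of_nat k + 1)"]
      unfolding norm_of_nat by simp
    finally have "2 * norm x * norm (?c (Suc k)) \<le> norm (?c k)"
      unfolding rec norm_mult by (intro mult_right_mono) (simp_all del: of_nat_Suc)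
    then have "2 * norm x * norm (?c (Suc k)) * norm (x ^ k) \<le> norm (?c k) * norm (x ^ k)"
      by (rule mult_right_mono) simp
    moreover have "norm (?c (Suc k) * x ^ Suc k) = norm x * norm (?c (Suc k)) * norm (x ^ k)"
      by (simp only: norm_mult power_Suc mult_ac)
    moreover have "norm (?c k * x ^ k) = norm (?c k) * norm (x ^ k)"
      by (rule norm_mult)
    ultimately show "norm (?c (Suc k) * x ^ Suc k) \<le> 1 / 2 * norm (?c k * x ^ k)"
      by linarith
  qed simp
qed

lemma hyper01_sums: "(\<lambda>k. rGamma (\<mu> + of_nat k + 1) / fact k * x ^ k) sums hyper01 \<mu> x"
  unfolding hyper01_def using summable_hyper01 by (rule summable_sums)

lemma DERIV_hyper01: "(hyper01 \<mu> has_field_derivative hyper01 (\<mu> + 1) x) (at x)"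
proof -
  have "diffs (\<lambda>k. rGamma (\<mu> + of_nat k + 1) / fact k)
      = (\<lambda>k. rGamma (\<mu> + 1 + of_nat k + 1) / fact k)"
    by (simp add: diffs_def fun_eq_iff del: of_nat_Suc) (simp add: add_ac)
  then show ?thesis
    using termdiffs_strong_converges_everywhere[OF summable_hyper01[of \<mu>], of x]
    unfolding hyper01_def[abs_def] by simp
qed

text \<open>Coefficientwise this is the functional equation of 1/\<Gamma>. With
  \<open>DERIV_hyper01\<close> it becomes the differential equation x h'' + (\<mu> + 1) h' = h, the
  form in which Bessel's equation is used below.\<close>

lemma hyper01_rec: "hyper01 \<mu> x = (\<mu> + 1) * hyper01 (\<mu> + 1) x + x * hyper01 (\<mu> + 2) x"
proof -
  let ?f = "\<lambda>k. rGamma (\<mu> + 2 + of_nat k + 1) / fact k * x ^ k * x"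
  let ?F = "\<lambda>k. case k of 0 \<Rightarrow> 0 | Suc k \<Rightarrow> ?f k"
  have "?f sums (hyper01 (\<mu> + 2) x * x)"
    by (intro sums_mult2 hyper01_sums)
  then have 1: "?F sums (x * hyper01 (\<mu> + 2) x)"
    using sums_Suc[of ?F] by (simp add: mult.commute)
  have 2: "(\<lambda>k. (\<mu> + 1) * (rGamma (\<mu> + 1 + of_nat k + 1) / fact k * x ^ k))
      sums ((\<mu> + 1) * hyper01 (\<mu> + 1) x)"
    by (intro sums_mult hyper01_sums)
  have "(\<mu> + 1) * (rGamma (\<mu> + 1 + of_nat k + 1) / fact k * x ^ k) + ?F k
      = rGamma (\<mu> + of_nat k + 1) / fact k * x ^ k" for k
  proof (cases k)
    case 0
    then show ?thesis using rGamma_plus1[of "\<mu> + 1"] by (simp add: add_ac)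
  next
    case (Suc j)
    have R: "rGamma (\<mu> + of_nat k + 1) = (\<mu> + 1 + of_nat (Suc j)) * rGamma (\<mu> + 2 + of_nat j + 1)"
      using rGamma_plus1[of "\<mu> + of_nat k + 1"] Suc by (simp add: add_ac)
    have E: "\<mu> + 1 + of_nat k + 1 = \<mu> + 2 + of_nat j + 1" using Suc by simp
    have "(\<mu> + 1) * (r / (J * F) * (y * x)) + r / F * y * x = (\<mu> + 1 + J) * r / (J * F) * (y * x)"
      if "J \<noteq> 0" "F \<noteq> 0" for J F r y :: complex
      using that by (simp add: field_simps)
    from this[of "of_nat (Suc j)" "fact j" "rGamma (\<mu> + 2 + of_nat j + 1)" "x ^ j"]
    show ?thesis unfolding R E unfolding Suc
      by (simp add: mult_ac del: of_nat_Suc)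
  qed
  with sums_add[OF 2 1] have "(\<lambda>k. rGamma (\<mu> + of_nat k + 1) / fact k * x ^ k) sums
      ((\<mu> + 1) * hyper01 (\<mu> + 1) x + x * hyper01 (\<mu> + 2) x)" by simp
  then show ?thesis using hyper01_sums sums_unique2 by blast
qed

text \<open>The factors z^\<nu> and (\<mu>/2)^\<mu> of J_\<mu>(\<mu> z), \<mu> = \<nu> + n, are left
  out, so that no branch of a power remains and the function is entire.\<close>

definition kapteyn_term :: "complex \<Rightarrow> nat \<Rightarrow> complex \<Rightarrow> complex" where
  "kapteyn_term \<nu> n z = z ^ n * hyper01 (\<nu> + of_nat n) (- (((\<nu> + of_nat n) * z / 2)\<^sup>2))"

lemma holomorphic_kapteyn_term: "kapteyn_term \<nu> n holomorphic_on S"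
proof -
  have "kapteyn_term \<nu> n field_differentiable at z" for z
    unfolding kapteyn_term_def[abs_def] field_differentiable_def
    by (rule exI, (rule derivative_eq_intros DERIV_chain2[OF DERIV_hyper01] refl | simp)+)
  then show ?thesis
    by (simp add: holomorphic_on_def field_differentiable_at_within)
qed

text \<open>\<open>(z d/dz - n) g\<^sub>n\<close>, which turns Bessel's equation into a first-order system.\<close>

definition kapteyn_aux :: "complex \<Rightarrow> nat \<Rightarrow> complex \<Rightarrow> complex" where
  "kapteyn_aux \<nu> n z = 2 * z ^ n * (- (((\<nu> + of_nat n) * z / 2)\<^sup>2)) *
     hyper01 (\<nu> + of_nat n + 1) (- (((\<nu> + of_nat n) * z / 2)\<^sup>2))"

text \<open>Together these give the factorised Bessel equation (D + 2 \<nu> + n)(D - n) g = -(\<mu>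
  z)^2 g with D = z d/dz. The inner argument x satisfies D x = 2 x, and \<open>hyper01_rec\<close>
  eliminates the second derivative.\<close>

lemma
  fixes z :: complex
  assumes z: "z \<noteq> 0"
  shows DERIV_kapteyn_term: "(kapteyn_term \<nu> n has_field_derivative
      (of_nat n * kapteyn_term \<nu> n z + kapteyn_aux \<nu> n z) / z) (at z)"
    and DERIV_kapteyn_aux: "(kapteyn_aux \<nu> n has_field_derivative
      (- (2 * \<nu> + of_nat n) * kapteyn_aux \<nu> n z - ((\<nu> + of_nat n) * z)\<^sup>2 * kapteyn_term \<nu> n z) / z) (at z)"
proof -
  define \<mu> where "\<mu> = \<nu> + of_nat n"
  define x where "x = (\<lambda>z. - ((\<mu> * z / 2)\<^sup>2))"
  have dx: "(x has_field_derivative 2 * x z / z) (at z)"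
    unfolding x_def using z
    by (auto intro!: derivative_eq_intros simp: field_simps power2_eq_square)
  have dpow: "((\<lambda>z. z ^ n) has_field_derivative of_nat n * z ^ n / z) (at z)"
    by (rule DERIV_cong[OF DERIV_power[OF DERIV_ident]]) (use z in \<open>cases n; simp\<close>)
  have dh: "((\<lambda>z. hyper01 m (x z)) has_field_derivative hyper01 (m + 1) (x z) * (2 * x z / z)) (at z)" for m
    by (rule DERIV_chain2[OF DERIV_hyper01 dx])
  have rec: "x z * hyper01 (\<mu> + 2) (x z) = hyper01 \<mu> (x z) - (\<mu> + 1) * hyper01 (\<mu> + 1) (x z)"
    using hyper01_rec[of \<mu> "x z"] by simp
  have P: "kapteyn_term \<nu> n = (\<lambda>z. z ^ n * hyper01 \<mu> (x z))"
    by (simp add: fun_eq_iff kapteyn_term_def x_def \<mu>_def)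
  have Q: "kapteyn_aux \<nu> n = (\<lambda>z. 2 * z ^ n * x z * hyper01 (\<mu> + 1) (x z))"
    by (simp add: fun_eq_iff kapteyn_aux_def x_def \<mu>_def)
  show "(kapteyn_term \<nu> n has_field_derivative
      (of_nat n * kapteyn_term \<nu> n z + kapteyn_aux \<nu> n z) / z) (at z)"
    unfolding P Q
    by (rule DERIV_cong[OF DERIV_mult[OF dpow dh]]) (use z in \<open>simp add: field_simps\<close>)
  have "(kapteyn_aux \<nu> n has_field_derivative
      2 * (of_nat n * z ^ n / z * x z + 2 * x z / z * z ^ n) * hyper01 (\<mu> + 1) (x z)
      + hyper01 (\<mu> + 1 + 1) (x z) * (2 * x z / z) * (2 * z ^ n * x z)) (at z)"
    unfolding Q
    by (rule DERIV_cong[OF DERIV_mult[OF DERIV_mult[OF DERIV_cmult[OF dpow, of 2] dx] dh]])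
       (simp add: algebra_simps)
  also have "hyper01 (\<mu> + 1 + 1) (x z) * (2 * x z / z) * (2 * z ^ n * x z)
      = (x z * hyper01 (\<mu> + 2) (x z)) * (4 * z ^ n * x z / z)"
    by (simp add: add.assoc)
  also have "2 * (of_nat n * z ^ n / z * x z + 2 * x z / z * z ^ n) * hyper01 (\<mu> + 1) (x z)
      + (x z * hyper01 (\<mu> + 2) (x z)) * (4 * z ^ n * x z / z)
      = (2 * (of_nat n - 2 * \<mu>) * z ^ n * x z * hyper01 (\<mu> + 1) (x z) + 4 * x z * z ^ n * hyper01 \<mu> (x z)) / z"
    unfolding rec using z by (simp add: field_simps)
  also have "4 * x z = - ((\<mu> * z)\<^sup>2)" by (simp add: x_def power2_eq_square)
  finally show "(kapteyn_aux \<nu> n has_field_derivative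
      (- (2 * \<nu> + of_nat n) * kapteyn_aux \<nu> n z - ((\<nu> + of_nat n) * z)\<^sup>2 * kapteyn_term \<nu> n z) / z) (at z)"
    by (rule DERIV_cong) (simp add: P Q \<mu>_def[symmetric], simp add: \<mu>_def algebra_simps)
qed

section \<open>Decay of the terms along rays to the origin\<close>

lemma one_minus_square_notin_nonpos:
  assumes "Im w \<noteq> 0"
  shows "1 - (of_real t * w)\<^sup>2 \<notin> \<real>\<^sub>\<le>\<^sub>0"
proof
  assume *: "1 - (of_real t * w)\<^sup>2 \<in> \<real>\<^sub>\<le>\<^sub>0"
  then have "Im (1 - (of_real t * w)\<^sup>2) = 0" "Re (1 - (of_real t * w)\<^sup>2) \<le> 0"
    by (auto simp: complex_nonpos_Reals_iff)
  \<comment> \<open>These say that (t w)^2 is real and at least 1. With Im w \<noteq> 0 the first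
    forces t = 0 or w imaginary, and then the square is at most 0.\<close>
  then have "t * t * (Re w * Im w) = 0" "1 \<le> t * t * ((Re w)\<^sup>2 - (Im w)\<^sup>2)"
    by (auto simp: power2_eq_square algebra_simps)
  moreover have "0 \<le> t * t * (Im w)\<^sup>2" by simp
  ultimately show False using assms
    by (cases "t = 0"; cases "Re w = 0") (auto simp: mult_le_0_iff not_le[symmetric])
qed

lemma Re_csqrt_pos:
  assumes "z \<notin> \<real>\<^sub>\<le>\<^sub>0"
  shows "Re (csqrt z) > 0"
proof (rule ccontr)
  assume "\<not> Re (csqrt z) > 0"
  then have "Re (csqrt z) = 0" using csqrt_principal[of z] by auto
  then have "(csqrt z)\<^sup>2 = of_real (- (Im (csqrt z))\<^sup>2)"
    by (simp add: complex_eq_iff power2_eq_square)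
  then show False using assms by (metis nonpos_Reals_of_real_iff power2_csqrt neg_le_0_iff_le zero_le_power2)
qed

text \<open>With s = csqrt (1 - z^2), the operator (D + \<nu>)^2 - \<mu>^2 s^2 equals (D + \<nu> +
  \<mu> s)(D + \<nu> - \<mu> s) up to the commutator \<mu> D s = -\<mu> z^2 / s, which is the
  coupling \<open>d\<close>. Its order n is that of the rates \<open>p\<close> and \<open>q\<close>,
  so the cone lemma applies with an aperture \<open>C\<close> independent of n.\<close>

lemma kapteyn_term_decay_single:
  fixes w \<nu> :: complex
  assumes w: "Im w \<noteq> 0"
    and s1: "\<And>t. 0 \<le> t \<Longrightarrow> t \<le> 1 \<Longrightarrow> \<sigma> \<le> Re (csqrt (1 - (of_real t * w)\<^sup>2))"
    and s2: "\<And>t. 0 \<le> t \<Longrightarrow> t \<le> 1 \<Longrightarrow> norm (csqrt (1 - (of_real t * w)\<^sup>2)) \<le> S"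
    and \<sigma>: "\<sigma> > 0" and c: "(norm w)\<^sup>2 / \<sigma> \<le> c"
    and n: "n > 0" "of_nat n * \<sigma> \<ge> 2 * (norm \<nu> * \<sigma> + (c / \<sigma> + 1) + 2 * norm \<nu> * (S + 1))"
    and t: "0 < t" "t \<le> 1"
  shows "norm (kapteyn_term \<nu> n (of_real t * w)) \<le> t powr (\<sigma> / 2 * n) * norm (kapteyn_term \<nu> n w)"
proof -
  have w0: "w \<noteq> 0" using w by auto
  define \<mu> where "\<mu> = \<nu> + of_nat n"
  define s where "s = (\<lambda>z. csqrt (1 - z\<^sup>2))"
  define P where "P = kapteyn_term \<nu> n"
  \<comment> \<open>\<open>Q = (D + \<nu> - \<mu> s) P\<close>, the defect of the WKB approximation \<open>(D + \<nu>) P \<approx> \<mu> s P\<close>\<close>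
  define Q where "Q = (\<lambda>z. \<mu> * (1 - s z) * kapteyn_term \<nu> n z + kapteyn_aux \<nu> n z)"
  define X where "X = (\<lambda>t. P (of_real t * w))"
  define Y where "Y = (\<lambda>t. Q (of_real t * w))"
  define p where "p = (\<lambda>t. \<mu> * s (of_real t * w) - \<nu>)"
  define q where "q = (\<lambda>t. \<mu> * s (of_real t * w) + \<nu>)"
  define d where "d = (\<lambda>t. - \<mu> * (of_real t * w)\<^sup>2 / s (of_real t * w))"
  define \<rho> where "\<rho> = of_nat n * \<sigma> - norm \<nu> * (S + 1)"
  define \<delta> where "\<delta> = (of_nat n + norm \<nu>) * c"
  \<comment> \<open>Chosen so that \<open>c / C \<le> \<sigma>\<close>: then
    \<open>\<delta> / C\<close> uses up about half of \<open>2 * \<rho>\<close>, and for large n the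
    other half absorbs \<open>C\<close> and the terms in \<nu>.\<close>
  define C where "C = c / \<sigma> + 1"
  have c0: "c \<ge> 0" using c \<sigma> by (meson divide_nonneg_pos order_trans zero_le_power2)
  have C: "C > 0" using c0 \<sigma> by (simp add: C_def add_nonneg_pos)
  have S0: "S \<ge> 0" using s2[of 0] by (meson norm_ge_zero order_trans zero_le_one order_refl)
  have snz: "s (of_real t * w) \<noteq> 0" if "0 \<le> t" "t \<le> 1" for t :: real
    using s1[OF that] \<sigma> by (auto simp: s_def)
  have dP: "(P has_field_derivative ((\<mu> * s z - \<nu>) * P z + Q z) / z) (at z)" if "z \<noteq> 0" for z
    unfolding P_def
    by (rule DERIV_cong[OF DERIV_kapteyn_term[OF that]]) (simp add: Q_def \<mu>_def algebra_simps)
  have dQ: "(Q has_field_derivative (- (\<mu> * s z + \<nu>) * Q z - (- \<mu> * z\<^sup>2 / s z) * P z) / z) (at z)"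
    if "z \<noteq> 0" "1 - z\<^sup>2 \<notin> \<real>\<^sub>\<le>\<^sub>0" for z
  proof -
    have sz: "s z \<noteq> 0" "(s z)\<^sup>2 = 1 - z\<^sup>2" using that(2) by (auto simp: s_def)
    have z2: "z\<^sup>2 = 1 - (s z)\<^sup>2" using sz by simp
    have ds: "(s has_field_derivative - z / s z) (at z)"
      unfolding s_def using that
      by (auto intro!: derivative_eq_intros DERIV_chain2[OF has_field_derivative_csqrt] simp: field_simps)
    have "(Q has_field_derivative
       ((\<mu> * z / s z) * kapteyn_term \<nu> n z
        + (of_nat n * kapteyn_term \<nu> n z + kapteyn_aux \<nu> n z) / z * (\<mu> * (1 - s z)))
       + (- (2 * \<nu> + of_nat n) * kapteyn_aux \<nu> n z - (\<mu> * z)\<^sup>2 * kapteyn_term \<nu> n z) / z) (at z)"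
      unfolding Q_def
      by (rule DERIV_add[OF DERIV_mult[OF _ DERIV_kapteyn_term[OF that(1)]]
            DERIV_kapteyn_aux[OF that(1), of \<nu> n, folded \<mu>_def]])
         (auto intro!: derivative_eq_intros ds)
    then show ?thesis
    proof (rule DERIV_cong)
      have "z * (x * a + A / z * B + D / z) = z * x * a + A * B + D" for x a A B D
        using that(1) by (simp add: field_simps)
      moreover have "z * (\<mu> * z / s z) = \<mu> * z\<^sup>2 / s z" by (simp add: power2_eq_square)
      ultimately have "z * (\<mu> * z / s z * kapteyn_term \<nu> n z
        + (of_nat n * kapteyn_term \<nu> n z + kapteyn_aux \<nu> n z) / z * (\<mu> * (1 - s z))
       + (- (2 * \<nu> + of_nat n) * kapteyn_aux \<nu> n z - (\<mu> * z)\<^sup>2 * kapteyn_term \<nu> n z) / z)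
       = \<mu> * z\<^sup>2 / s z * kapteyn_term \<nu> n z
        + (of_nat n * kapteyn_term \<nu> n z + kapteyn_aux \<nu> n z) * (\<mu> * (1 - s z))
       + (- (2 * \<nu> + of_nat n) * kapteyn_aux \<nu> n z - \<mu>\<^sup>2 * z\<^sup>2 * kapteyn_term \<nu> n z)"
        by (simp only: power_mult_distrib)
      also have "\<dots> = - (\<mu> * s z + \<nu>) * Q z - (- \<mu> * z\<^sup>2 / s z) * P z"
      proof -
        \<comment> \<open>Writing z^2 as 1 - s^2 lets \<mu> (1 - s) factor out of the coefficient of
          g, which reassembles \<open>Q\<close>.\<close>
        have "(of_nat n * A + B) * (\<mu> * (1 - r)) + (- (2 * \<nu> + of_nat n) * B - \<mu>\<^sup>2 * (1 - r\<^sup>2) * A)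
          = - (\<mu> * r + \<nu>) * (\<mu> * (1 - r) * A + B)" for A B r
          unfolding \<mu>_def by (simp add: power2_eq_square algebra_simps)
        from this[of "kapteyn_term \<nu> n z" "kapteyn_aux \<nu> n z" "s z"]
        show ?thesis unfolding z2[symmetric] Q_def P_def by simp
      qed
      finally show "((\<mu> * z / s z) * kapteyn_term \<nu> n z
        + (of_nat n * kapteyn_term \<nu> n z + kapteyn_aux \<nu> n z) / z * (\<mu> * (1 - s z)))
       + (- (2 * \<nu> + of_nat n) * kapteyn_aux \<nu> n z - (\<mu> * z)\<^sup>2 * kapteyn_term \<nu> n z) / z
       = (- (\<mu> * s z + \<nu>) * Q z - (- \<mu> * z\<^sup>2 / s z) * P z) / z"
        using that(1) by (metis nonzero_mult_div_cancel_left)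
    qed
  qed
  \<comment> \<open>Along z = t w the operator t d/dt is z d/dz, so the direction w drops
    out.\<close>
  have ray: "((\<lambda>t. F (of_real t * w)) has_vector_derivative F' /\<^sub>R t) (at t)"
    if "(F has_field_derivative F' / (of_real t * w)) (at (of_real t * w))" for F F' and t :: real
  proof (rule has_vector_derivative_real_field)
    have "((\<lambda>z. F (z * w)) has_field_derivative F' / (of_real t * w) * w) (at (of_real t))"
      by (rule DERIV_chain2[where f = F and g = "\<lambda>z. z * w" and x = "of_real t", OF that]) (auto intro!: derivative_eq_intros)
    then show "((\<lambda>z. F (z * w)) has_field_derivative F' /\<^sub>R t) (at (of_real t))"
      by (rule DERIV_cong) (use w0 in \<open>simp add: scaleR_conv_of_real divide_inverse\<close>)
  qed
  have derX: "(X has_vector_derivative (p t * X t + Y t) /\<^sub>R t) (at t)" if "0 < t" "t < 1" for t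
    unfolding X_def Y_def p_def by (rule ray, rule dP) (use that w0 in auto)
  have derY: "(Y has_vector_derivative (- q t * Y t - d t * X t) /\<^sub>R t) (at t)" if "0 < t" "t < 1" for t
    unfolding X_def Y_def q_def d_def
    by (rule ray, rule dQ) (use that w0 one_minus_square_notin_nonpos[OF w, of t] in auto)
  have conth: "continuous_on UNIV (hyper01 m)" for m
    using DERIV_hyper01 DERIV_isCont continuous_at_imp_continuous_on by blast
  have contX: "continuous_on {0..1} X"
    unfolding X_def P_def kapteyn_term_def
    by (intro continuous_intros continuous_on_compose2[OF conth]) auto
  have conts: "continuous_on {0..1} (\<lambda>t. s (of_real t * w))"
    unfolding s_def
    by (rule continuous_on_compose2[OF continuous_on_csqrt])
       (use one_minus_square_notin_nonpos[OF w] in \<open>auto intro!: continuous_intros\<close>)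
  have contY: "continuous_on {0..1} Y"
    unfolding Y_def Q_def kapteyn_aux_def kapteyn_term_def
    by (intro continuous_intros continuous_on_compose2[OF conth] conts) auto
  \<comment> \<open>For n > 0 the factor z^n makes the solution start at the apex of the
    cone.\<close>
  have init: "X 0 = 0" "Y 0 = 0"
    using n(1) by (simp_all add: X_def Y_def P_def Q_def kapteyn_term_def kapteyn_aux_def)
  have Re\<mu>s: "Re (\<mu> * s (of_real t * w)) \<ge> of_nat n * \<sigma> - norm \<nu> * S" if "0 \<le> t" "t \<le> 1" for t
  proof -
    have "norm (\<nu> * s (of_real t * w)) \<le> norm \<nu> * S"
      using s2[OF that] by (simp add: norm_mult s_def mult_left_mono)
    then have "- Re (\<nu> * s (of_real t * w)) \<le> norm \<nu> * S"
      using complex_Re_le_cmod[of "- (\<nu> * s (of_real t * w))"] by simp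
    moreover have "of_nat n * \<sigma> \<le> of_nat n * Re (s (of_real t * w))"
      using s1[OF that] by (simp add: s_def mult_left_mono)
    ultimately show ?thesis by (simp add: \<mu>_def distrib_right)
  qed
  have Re\<nu>: "Re \<nu> \<le> norm \<nu>" "- Re \<nu> \<le> norm \<nu>"
    using complex_Re_le_cmod[of \<nu>] complex_Re_le_cmod[of "- \<nu>"] by auto
  have p: "\<rho> \<le> Re (p t)" and q: "\<rho> \<le> Re (q t)" if "0 < t" "t < 1" for t
    using Re\<mu>s[of t] that Re\<nu> by (simp_all add: p_def q_def \<rho>_def algebra_simps)
  have d: "norm (d t) \<le> \<delta>" if "0 < t" "t < 1" for t
  proof -
    have "norm (of_real t * w) \<le> norm w"
      using that by (simp add: norm_mult mult_left_le_one_le)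
    then have "(norm (of_real t * w))\<^sup>2 \<le> (norm w)\<^sup>2" by (simp add: power_mono)
    moreover have "norm (s (of_real t * w)) \<ge> \<sigma>"
      using order_trans[OF s1[of t] complex_Re_le_cmod] that unfolding s_def by simp
    ultimately have "(norm (of_real t * w))\<^sup>2 / norm (s (of_real t * w)) \<le> (norm w)\<^sup>2 / \<sigma>"
      using \<sigma> by (intro frac_le) auto
    then have "(norm (of_real t * w))\<^sup>2 / norm (s (of_real t * w)) \<le> c" using c by simp
    moreover have "norm \<mu> \<le> of_nat n + norm \<nu>"
      unfolding \<mu>_def using norm_triangle_ineq[of \<nu> "of_nat n"] by simp
    ultimately have "norm \<mu> * ((norm (of_real t * w))\<^sup>2 / norm (s (of_real t * w))) \<le> \<delta>"
      unfolding \<delta>_def by (intro mult_mono) auto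
    then show ?thesis by (simp add: d_def norm_divide norm_mult norm_power)
  qed
  have "c / C \<le> \<sigma>" using C \<sigma> c0 by (simp add: C_def field_simps)
  then have "\<delta> / C \<le> (of_nat n + norm \<nu>) * \<sigma>"
    unfolding \<delta>_def using mult_left_mono[of "c / C" \<sigma> "of_nat n + norm \<nu>"] by simp
  moreover have nn: "of_nat n * \<sigma> \<ge> 2 * (norm \<nu> * \<sigma> + C + 2 * (norm \<nu> * (S + 1)))"
    using n(2) by (simp add: C_def)
  moreover have pos: "0 \<le> norm \<nu> * \<sigma>" "0 \<le> norm \<nu> * (S + 1)" using S0 \<sigma> by auto
  moreover have "x + C \<le> 2 * (m - y)"
    if "x \<le> m + a" "m \<ge> 2 * (a + C + 2 * y)" "0 \<le> a" "0 \<le> y" for x m a y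
    using that C by argo
  ultimately have dC: "\<delta> / C + C \<le> 2 * \<rho>"
    unfolding \<rho>_def distrib_right[of "of_nat n"] by blast
  have cone: "norm (Y t) \<le> C * norm (X t)" if "0 < t" "t < 1" for t
    by (rule ode_cone_bound[OF contX contY init derX derY p q d C dC]) (use that in auto)
  have "\<sigma> / 2 * of_nat n \<le> \<rho> - C"
    using nn pos C unfolding \<rho>_def by (simp add: mult.commute[of \<sigma>])
  from ode_growth_bound[OF contX derX p cone this t]
  show ?thesis by (simp add: X_def P_def)
qed

text \<open>Compactness of [0,1] x K gives a positive lower bound \<sigma> for Re sqrt(1 - (t w)^2)
  and upper bounds for the other data, so that rate and threshold are uniform in w.\<close>

lemma kapteyn_term_decay:
  assumes K: "compact K" "\<And>w. w \<in> K \<Longrightarrow> Im w \<noteq> 0"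
  obtains \<kappa> :: real and n0 :: nat where "\<kappa> > 0"
    "\<And>n w t. n \<ge> n0 \<Longrightarrow> w \<in> K \<Longrightarrow> 0 < t \<Longrightarrow> t \<le> 1 \<Longrightarrow>
      norm (kapteyn_term \<nu> n (of_real t * w)) \<le> t powr (\<kappa> * n) * norm (kapteyn_term \<nu> n w)"
proof (cases "K = {}")
  case True
  then show ?thesis using that[of 1 0] by auto
next
  case False
  define s where "s = (\<lambda>(t::real, w). csqrt (1 - (of_real t * w)\<^sup>2))"
  let ?T = "{0..1::real} \<times> K"
  have T: "compact ?T" "?T \<noteq> {}" using K(1) False by (auto intro: compact_Times)
  have nonpos: "1 - (of_real t * w)\<^sup>2 \<notin> \<real>\<^sub>\<le>\<^sub>0" if "w \<in> K" for t w
    using one_minus_square_notin_nonpos K(2) that by blast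
  have cont: "continuous_on ?T s"
    unfolding s_def case_prod_beta
    by (rule continuous_on_compose2[OF continuous_on_csqrt])
       (use nonpos in \<open>auto intro!: continuous_intros\<close>)
  obtain x0 where x0: "x0 \<in> ?T" "\<And>x. x \<in> ?T \<Longrightarrow> Re (s x0) \<le> Re (s x)"
    using continuous_attains_inf[OF T continuous_on_Re[OF cont]] by blast
  define \<sigma> where "\<sigma> = Re (s x0)"
  have \<sigma>: "\<sigma> > 0"
  proof -
    obtain t w where "x0 = (t, w)" "w \<in> K" using x0(1) by auto
    then have "s x0 = csqrt (1 - (of_real t * w)\<^sup>2)" "1 - (of_real t * w)\<^sup>2 \<notin> \<real>\<^sub>\<le>\<^sub>0"
      using nonpos by (auto simp: s_def)
    then show ?thesis by (metis Re_csqrt_pos \<sigma>_def)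
  qed
  obtain x1 where x1: "\<And>x. x \<in> ?T \<Longrightarrow> norm (s x) \<le> norm (s x1)"
    using continuous_attains_sup[OF T continuous_on_norm[OF cont]] by blast
  define S where "S = norm (s x1)"
  obtain w1 :: complex where w1: "\<And>w. w \<in> K \<Longrightarrow> norm w \<le> norm w1"
    using continuous_attains_sup[OF K(1) False continuous_on_norm[OF continuous_on_id]] by auto
  define c where "c = (norm w1)\<^sup>2 / \<sigma>"
  define R where "R = 2 * (norm \<nu> * \<sigma> + (c / \<sigma> + 1) + 2 * norm \<nu> * (S + 1))"
  obtain n1 :: nat where n1: "R / \<sigma> \<le> n1" using real_arch_simple by blast
  show ?thesis
  \<comment> \<open>Half of \<sigma> n is given up to the error terms; \<open>Suc\<close> ensures n
    > 0.\<close>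
  proof (rule that[of "\<sigma> / 2" "Suc n1"])
    fix n w and t :: real assume n: "n \<ge> Suc n1" and w: "w \<in> K" and t: "0 < t" "t \<le> 1"
    have "R \<le> n1 * \<sigma>" using n1 \<sigma> by (simp add: pos_divide_le_eq)
    also have "\<dots> \<le> n * \<sigma>" using n \<sigma> by (intro mult_right_mono) auto
    finally have R: "n * \<sigma> \<ge> R" .
    show "norm (kapteyn_term \<nu> n (of_real t * w)) \<le> t powr (\<sigma> / 2 * n) * norm (kapteyn_term \<nu> n w)"
    proof (rule kapteyn_term_decay_single[where S = S and c = c, OF K(2)[OF w] _ _ \<sigma> _ _ _ t])
      show "(norm w)\<^sup>2 / \<sigma> \<le> c" unfolding c_def
        using w1[OF w] \<sigma> by (intro divide_right_mono power_mono) auto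
      show "\<sigma> \<le> Re (csqrt (1 - (of_real t * w)\<^sup>2))" "norm (csqrt (1 - (of_real t * w)\<^sup>2)) \<le> S"
        if "0 \<le> t" "t \<le> 1" for t :: real
        using x0(2)[of "(t, w)"] x1[of "(t, w)"] that w by (auto simp: \<sigma>_def S_def s_def)
    qed (use n R in \<open>auto simp: R_def\<close>)
  qed (use \<sigma> in auto)
qed

subsection \<open>Coefficient comparison\<close>

text \<open>The closed sets \<open>E k\<close>, on which every |u n| is at most k, cover the disc;
  by Baire's theorem one of them contains a smaller disc.\<close>

lemma pointwise_bounded_imp_bounded_on_cball:
  fixes u :: "nat \<Rightarrow> complex \<Rightarrow> complex"
  assumes r: "r > 0" and cont: "\<And>n. continuous_on (cball c r) (u n)"
    and bdd: "\<And>z. z \<in> cball c r \<Longrightarrow> \<exists>M. \<forall>n. norm (u n z) \<le> M"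
  obtains c' r' M where "r' > 0" "cball c' r' \<subseteq> cball c r"
    "\<And>n z. z \<in> cball c' r' \<Longrightarrow> norm (u n z) \<le> M"
proof -
  define S where "S = cball c r"
  define E where "E = (\<lambda>k::nat. {z \<in> S. \<forall>n. norm (u n z) \<le> k})"
  have closed_E: "closed (E k)" for k
  proof -
    have "closed {z \<in> S. norm (u n z) \<le> k}" for n
      unfolding S_def by (intro continuous_on_closed_Collect_le continuous_intros cont closed_cball)
    moreover have "E k = (\<Inter>n. {z \<in> S. norm (u n z) \<le> k})" by (auto simp: E_def)
    ultimately show ?thesis by auto
  qed
  have empty: "(\<Inter>k. S - E k) = {}"
  proof -
    have "\<exists>k. z \<in> E k" if "z \<in> S" for z
    proof -
      obtain M where M: "\<And>n. norm (u n z) \<le> M" using bdd \<open>z \<in> S\<close> unfolding S_def by blast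
      obtain k :: nat where "M \<le> k" using real_arch_simple by blast
      then have "z \<in> E k" using that M order_trans unfolding E_def by blast
      then show ?thesis ..
    qed
    then show ?thesis by blast
  qed
  then have *: "\<not> S \<subseteq> closure (\<Inter>(range (\<lambda>k. S - E k)))"
    unfolding empty using r by (simp add: S_def)
  have op: "openin (top_of_set S) (S - E k)" for k
    unfolding openin_open by (rule exI[of _ "- E k"]) (use closed_E in auto)
  have "\<exists>k. \<not> S \<subseteq> closure (S - E k)"
  proof (rule ccontr)
    assume "\<not> (\<exists>k. \<not> S \<subseteq> closure (S - E k))"
    then have "S \<subseteq> closure (\<Inter>(range (\<lambda>k. S - E k)))"
      using op by (intro Baire) (auto simp: S_def)
    with * show False by blast
  qed
  then obtain k x where x: "x \<in> S" "x \<notin> closure (S - E k)" by blast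
  then obtain e where e: "e > 0" "ball x e \<inter> (S - E k) = {}"
    using open_contains_ball[of "- closure (S - E k)"] closure_subset[of "S - E k"] by force
  \<comment> \<open>The point x may lie on the boundary circle, so a nearby point of the open disc
    becomes the new centre.\<close>
  have "x \<in> closure (ball c r)" using x r by (simp add: S_def)
  then obtain y where y: "y \<in> ball c r" "dist y x < e" using e(1) closure_approachable by blast
  then have "y \<in> ball x e \<inter> ball c r" by (simp add: dist_commute)
  then obtain r' where r': "r' > 0" "cball y r' \<subseteq> ball x e \<inter> ball c r"
    using open_contains_cball[of "ball x e \<inter> ball c r"] by (meson open_Int open_ball)
  show ?thesis
  proof (rule that[OF r'(1)])
    show "cball y r' \<subseteq> cball c r" using r'(2) by auto
    show "norm (u n z) \<le> real k" if "z \<in> cball y r'" for n z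
    proof -
      have "z \<in> ball x e" "z \<in> S" using that r'(2) by (auto simp: S_def)
      then show ?thesis using e(2) by (auto simp: E_def)
    qed
  qed
qed

text \<open>By induction the lower coefficients vanish, so h(t) / (t w)^j tends to d_j as t
  decreases to 0, while its bound, a constant times t^(p - j), tends to 0.\<close>

lemma powser_coeff_eq_0_of_ray_decay:
  fixes d :: "nat \<Rightarrow> complex" and w :: complex
  assumes w: "w \<noteq> 0" and \<delta>: "\<delta> > 0"
    and h: "\<And>t. 0 < t \<Longrightarrow> t < \<delta> \<Longrightarrow> (\<lambda>j. d j * (of_real t * w) ^ j) sums h t"
    and le: "\<And>t. 0 < t \<Longrightarrow> t < \<delta> \<Longrightarrow> norm (h t) \<le> B * t powr p"
  shows "real j < p \<Longrightarrow> d j = 0"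
proof (induction j rule: less_induct)
  case (less j)
  define g where "g = (\<lambda>z. \<Sum>i. d (i + j) * z ^ i)"
  define K where "K = of_real (\<delta> / 2) * w"
  have K: "norm K > 0" using w \<delta> by (simp add: K_def)
  have shift: "(\<lambda>i. d (i + j) * (of_real t * w) ^ i) sums (h t / (of_real t * w) ^ j)"
    if "0 < t" "t < \<delta>" for t
  proof -
    have "(\<lambda>i. d (i + j) * (of_real t * w) ^ (i + j)) sums (h t - (\<Sum>i<j. d i * (of_real t * w) ^ i))"
      using sums_split_initial_segment[OF h[OF that]] .
    also have "(\<Sum>i<j. d i * (of_real t * w) ^ i) = 0"
      using less by (intro sum.neutral) auto
    finally have "(\<lambda>i. d (i + j) * (of_real t * w) ^ (i + j) / (of_real t * w) ^ j)
        sums (h t / (of_real t * w) ^ j)"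
      using sums_divide by fastforce
    then show ?thesis using that w by (simp add: power_add)
  qed
  have "summable (\<lambda>i. d (i + j) * K ^ i)"
    unfolding K_def using shift[of "\<delta> / 2"] \<delta> by (auto simp: sums_iff)
  then have "isCont g 0"
    unfolding g_def by (rule isCont_powser) (use K in auto)
  moreover have "((\<lambda>t. of_real t * w) \<longlongrightarrow> 0) (at_right 0)"
    by (auto intro!: tendsto_eq_intros)
  ultimately have "((\<lambda>t. g (of_real t * w)) \<longlongrightarrow> g 0) (at_right 0)"
    by (rule isCont_tendsto_compose)
  then have lim: "((\<lambda>t. g (of_real t * w)) \<longlongrightarrow> d j) (at_right 0)"
    by (simp add: g_def powser_zero)
  have ev: "eventually (\<lambda>t. t \<in> {0<..<\<delta>}) (at_right 0)"
    using \<delta> by (rule eventually_at_right_real)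
  have "((\<lambda>t. g (of_real t * w)) \<longlongrightarrow> 0) (at_right 0)"
  proof (rule Lim_null_comparison)
    show "\<forall>\<^sub>F t in at_right 0. norm (g (of_real t * w)) \<le> B / norm w ^ j * t powr (p - j)"
      using ev
    proof eventually_elim
      case (elim t)
      then have t: "0 < t" "t < \<delta>" by auto
      have "g (of_real t * w) = h t / (of_real t * w) ^ j"
        unfolding g_def using shift[OF t] by (simp add: sums_iff)
      then have "norm (g (of_real t * w)) = norm (h t) / (t ^ j * norm w ^ j)"
        using t by (simp add: norm_divide norm_mult norm_power power_mult_distrib)
      also have "\<dots> \<le> B * t powr p / (t ^ j * norm w ^ j)"
        using le[OF t] t by (intro divide_right_mono) auto
      also have "\<dots> = B / norm w ^ j * t powr (p - j)"
        using t by (simp add: powr_diff powr_realpow)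
      finally show ?case .
    qed
    have "((\<lambda>t::real. t powr (p - j)) \<longlongrightarrow> 0 powr (p - j)) (at_right 0)"
      using less.prems by (intro tendsto_powr2) (auto simp: eventually_at_right_less intro!: tendsto_intros eventually_mono[OF ev])
    then have "((\<lambda>t::real. B / norm w ^ j * t powr (p - j)) \<longlongrightarrow> B / norm w ^ j * 0) (at_right 0)"
      by (intro tendsto_mult tendsto_const) simp
    then show "((\<lambda>t::real. B / norm w ^ j * t powr (p - j)) \<longlongrightarrow> 0) (at_right 0)" by simp
  qed
  with lim show "d j = 0" using tendsto_unique[of "at_right (0::real)"] by (metis trivial_limit_at_right_real)
qed

text \<open>The Taylor coefficients of \<open>kapteyn_term \<nu> n\<close>, indexed by the exponent
  j = n + 2 k instead of k, so that terms with different n can be compared at the same power of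
  z.\<close>

definition kapteyn_coeff :: "complex \<Rightarrow> nat \<Rightarrow> nat \<Rightarrow> complex" where
  "kapteyn_coeff \<nu> n j = (if n \<le> j \<and> even (j - n)
     then rGamma (\<nu> + of_nat n + of_nat ((j - n) div 2) + 1) / fact ((j - n) div 2)
       * (- (((\<nu> + of_nat n) / 2)\<^sup>2)) ^ ((j - n) div 2)
     else 0)"

lemma kapteyn_term_sums: "(\<lambda>j. kapteyn_coeff \<nu> n j * z ^ j) sums kapteyn_term \<nu> n z"
proof -
  let ?F = "\<lambda>j. kapteyn_coeff \<nu> n j * z ^ j"
  have "(\<lambda>k. z ^ n * (rGamma (\<nu> + of_nat n + of_nat k + 1) / fact k
      * (- (((\<nu> + of_nat n) * z / 2)\<^sup>2)) ^ k)) sums kapteyn_term \<nu> n z"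
    unfolding kapteyn_term_def by (intro sums_mult hyper01_sums)
  also have "(\<lambda>k. z ^ n * (rGamma (\<nu> + of_nat n + of_nat k + 1) / fact k
      * (- (((\<nu> + of_nat n) * z / 2)\<^sup>2)) ^ k)) = (\<lambda>k. ?F (n + 2 * k))"
  proof
    fix k
    have "- (((\<nu> + of_nat n) * z / 2)\<^sup>2) = - (((\<nu> + of_nat n) / 2)\<^sup>2) * z\<^sup>2"
      by (simp add: power_mult_distrib power_divide)
    then have "(- (((\<nu> + of_nat n) * z / 2)\<^sup>2)) ^ k = (- (((\<nu> + of_nat n) / 2)\<^sup>2)) ^ k * z ^ (2 * k)"
      by (simp only: power_mult_distrib power_mult)
    then show "z ^ n * (rGamma (\<nu> + of_nat n + of_nat k + 1) / fact k
      * (- (((\<nu> + of_nat n) * z / 2)\<^sup>2)) ^ k) = ?F (n + 2 * k)"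
      by (simp add: kapteyn_coeff_def power_add)
  qed
  finally have "(\<lambda>k. ?F (n + 2 * k)) sums kapteyn_term \<nu> n z" .
  moreover have "?F j = 0" if "j \<notin> range (\<lambda>k. n + 2 * k)" for j
  proof -
    have "\<not> (n \<le> j \<and> even (j - n))"
    proof
      assume "n \<le> j \<and> even (j - n)"
      then obtain k where "j - n = 2 * k" "n \<le> j" by blast
      then have "j = n + 2 * k" by simp
      then show False using that by blast
    qed
    then show ?thesis by (metis kapteyn_coeff_def mult_zero_left)
  qed
  ultimately show ?thesis
    using sums_mono_reindex[of "\<lambda>k. n + 2 * k" ?F] by (simp add: strict_mono_def)
qed

text \<open>Only indices n \<le> s of the same parity as s contribute to z^s, and these are n = s -
  2 m.\<close>

lemma sum_kapteyn_coeff: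
  assumes "s < N"
  shows "(\<Sum>n<N. A n * kapteyn_coeff \<nu> n s)
    = (\<Sum>m\<le>s div 2. A (s - 2 * m) * kapteyn_coeff \<nu> (s - 2 * m) s)"
proof -
  have inj: "inj_on (\<lambda>m. s - 2 * m) {..s div 2}" by (auto simp: inj_on_def)
  have "(\<Sum>m\<le>s div 2. A (s - 2 * m) * kapteyn_coeff \<nu> (s - 2 * m) s)
      = (\<Sum>n\<in>(\<lambda>m. s - 2 * m) ` {..s div 2}. A n * kapteyn_coeff \<nu> n s)"
    by (simp add: sum.reindex[OF inj])
  also have "\<dots> = (\<Sum>n<N. A n * kapteyn_coeff \<nu> n s)"
  proof (rule sum.mono_neutral_left)
    show "\<forall>n\<in>{..<N} - (\<lambda>m. s - 2 * m) ` {..s div 2}. A n * kapteyn_coeff \<nu> n s = 0"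
    proof
      fix n assume n: "n \<in> {..<N} - (\<lambda>m. s - 2 * m) ` {..s div 2}"
      have "\<not> (n \<le> s \<and> even (s - n))"
      proof
        assume *: "n \<le> s \<and> even (s - n)"
        then have "n = s - 2 * ((s - n) div 2)" "(s - n) div 2 \<le> s div 2" by (auto simp: div_le_mono)
        then show False using n by blast
      qed
      then show "A n * kapteyn_coeff \<nu> n s = 0" by (metis kapteyn_coeff_def mult_zero_right)
    qed
  qed (use assms in auto)
  finally show ?thesis by simp
qed

text \<open>The link between the given disc and the origin: after the disc is shrunk, the series is
  studied on the cone of its multiples t w, 0 < t < 1, and coefficients are read off along the ray
  through the centre.\<close>

lemma kapteyn_series_coeffs:
  fixes A b :: "nat \<Rightarrow> complex"
  assumes r: "r > 0" and nonreal: "\<And>z. z \<in> cball c r \<Longrightarrow> Im z \<noteq> 0"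
    and sb: "\<And>z. z \<in> cball c r \<Longrightarrow> summable (\<lambda>m. b m * z ^ m)"
    and sA: "\<And>z. z \<in> cball c r \<Longrightarrow> (\<lambda>n. A n * kapteyn_term \<nu> n z) sums (\<Sum>m. b m * z ^ m)"
  shows "b s = (\<Sum>m\<le>s div 2. A (s - 2 * m) * kapteyn_coeff \<nu> (s - 2 * m) s)"
proof -
  define f where "f = (\<lambda>z. \<Sum>m. b m * z ^ m)"
  define u where "u = (\<lambda>n z. A n * kapteyn_term \<nu> n z)"
  have holu: "u n holomorphic_on S" for n S
    unfolding u_def by (intro holomorphic_intros holomorphic_kapteyn_term)
  have "\<exists>M. \<forall>n. norm (u n z) \<le> M" if "z \<in> cball c r" for z
  proof -
    have "(\<lambda>n. u n z) \<longlonglongrightarrow> 0"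
      using sA[OF that] unfolding u_def by (intro summable_LIMSEQ_zero) (auto simp: sums_iff)
    then have "Bseq (\<lambda>n. u n z)" by (intro convergent_imp_Bseq convergentI)
    then show ?thesis unfolding Bseq_def by blast
  qed
  \<comment> \<open>Convergence bounds the terms only point by point; a common bound requires a
    smaller disc.\<close>
  then obtain c' r' M where r': "r' > 0" and sub: "cball c' r' \<subseteq> cball c r"
    and M: "\<And>n z. z \<in> cball c' r' \<Longrightarrow> norm (u n z) \<le> M"
    using pointwise_bounded_imp_bounded_on_cball[OF r, of c u] holu holomorphic_on_imp_continuous_on
    by metis
  have nonreal': "\<And>z. z \<in> cball c' r' \<Longrightarrow> Im z \<noteq> 0" using nonreal sub by blast
  have c0: "c' \<noteq> 0" using nonreal'[of c'] r' by auto
  have M0: "M \<ge> 0" using order_trans[OF norm_ge_zero M[of c' 0]] r' by simp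
  obtain \<kappa> :: real and n0 :: nat where \<kappa>: "\<kappa> > 0" and decay: "\<And>n w t. n \<ge> n0 \<Longrightarrow> w \<in> cball c' r' \<Longrightarrow> 0 < t \<Longrightarrow> t \<le> 1 \<Longrightarrow>
      norm (kapteyn_term \<nu> n (of_real t * w)) \<le> t powr (\<kappa> * n) * norm (kapteyn_term \<nu> n w)"
    using kapteyn_term_decay[OF compact_cball nonreal', where \<nu> = \<nu>] by blast
  have bound: "norm (u n (of_real t * w)) \<le> M * (\<tau> powr \<kappa>) ^ n"
    if "n \<ge> n0" "w \<in> cball c' r'" "0 < t" "t \<le> \<tau>" "\<tau> \<le> 1" for n w and t \<tau> :: real
  proof -
    have "norm (u n (of_real t * w)) \<le> t powr (\<kappa> * n) * norm (u n w)"
      using mult_left_mono[OF decay[OF that(1-3)], of "norm (A n)"] that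
      by (simp add: u_def norm_mult mult_ac)
    also have "\<dots> \<le> \<tau> powr (\<kappa> * n) * M"
      using that M[OF that(2)] \<kappa> by (intro mult_mono powr_mono2) auto
    also have "\<tau> powr (\<kappa> * n) = (\<tau> powr \<kappa>) ^ n"
      using that by (simp add: powr_powr[symmetric] powr_realpow)
    finally show ?thesis by (simp add: mult.commute)
  qed
  \<comment> \<open>A truncated cone with apex 0. On \<open>U \<tau>\<close> with 0 < \<tau> < 1 a
    geometric series of ratio \<tau>^\<kappa> dominates the terms from \<open>n0\<close> on, and
    these sets exhaust \<open>U 1\<close>.\<close>
  define U where "U = (\<lambda>\<tau>::real. \<Union>t\<in>{0<..<\<tau>}. (\<lambda>x. t *\<^sub>R x) ` ball c' r')"
  have openU: "open (U \<tau>)" for \<tau>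
    unfolding U_def by (intro open_UN ballI open_scaling) auto
  have Umono: "U \<tau> \<subseteq> U \<tau>'" if "\<tau> \<le> \<tau>'" for \<tau> \<tau>'
    unfolding U_def using that by (intro UN_mono) auto
  have geom: "summable (\<lambda>n. M * (\<tau> powr \<kappa>) ^ (n + N))" if "0 < \<tau>" "\<tau> < 1" for \<tau> N
  proof -
    have "\<tau> powr \<kappa> < 1" using that \<kappa> powr_less_mono2[of \<kappa> \<tau> 1] by simp
    then show ?thesis
      by (simp add: power_add mult.assoc[symmetric] summable_mult2 summable_mult summable_geometric)
  qed
  define T where "T = (\<lambda>z. \<Sum>n. u (n + n0) z)"
  have unif: "uniform_limit (U \<tau>) (\<lambda>n z. \<Sum>i<n. u (i + n0) z) T sequentially"
    if "0 < \<tau>" "\<tau> < 1" for \<tau>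
    unfolding T_def
  proof (rule Weierstrass_m_test[OF _ geom[OF that, of n0]])
    fix n z assume "z \<in> U \<tau>"
    then obtain t w where "z = of_real t * w" "0 < t" "t < \<tau>" "w \<in> ball c' r'"
      by (auto simp: U_def scaleR_conv_of_real)
    then show "norm (u (n + n0) z) \<le> M * (\<tau> powr \<kappa>) ^ (n + n0)"
      using bound[of "n + n0" w t \<tau>] that by auto
  qed
  have holT: "T holomorphic_on U 1"
  proof (rule holomorphic_uniform_sequence[OF openU])
    show "(\<lambda>z. \<Sum>i<n. u (i + n0) z) holomorphic_on U 1" for n
      by (intro holomorphic_intros holu)
    fix x assume "x \<in> U 1"
    then obtain t w where x: "x = t *\<^sub>R w" "0 < t" "t < 1" "w \<in> ball c' r'" by (auto simp: U_def)
    obtain \<tau> where \<tau>: "t < \<tau>" "\<tau> < 1" using x dense by blast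
    then have "x \<in> U \<tau>" unfolding U_def x(1) using x by (intro UN_I[of t] imageI) auto
    then obtain d where d: "d > 0" "cball x d \<subseteq> U \<tau>"
      using openU open_contains_cball by blast
    then show "\<exists>d>0. cball x d \<subseteq> U 1 \<and>
        uniform_limit (cball x d) (\<lambda>n z. \<Sum>i<n. u (i + n0) z) T sequentially"
      using uniform_limit_on_subset[OF unif[of \<tau>] d(2)] Umono[of \<tau> 1] \<tau> x by auto
  qed
  define \<rho> where "\<rho> = norm c' + r'"
  \<comment> \<open>The point of the closed disc farthest from 0. Convergence of the power series
    there makes f holomorphic on the open ball of radius \<open>\<rho>\<close>, which contains the
    whole cone.\<close>
  define z1 where "z1 = c' + (r' / norm c') *\<^sub>R c'"
  have nz1: "norm z1 = \<rho>"
  proof -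
    have "z1 = (1 + r' / norm c') *\<^sub>R c'" by (simp add: z1_def scaleR_left_distrib)
    then show ?thesis using c0 r' by (simp add: \<rho>_def field_simps)
  qed
  have "z1 \<in> cball c' r'" using c0 r' by (simp add: z1_def dist_norm)
  then have sz1: "summable (\<lambda>m. b m * z1 ^ m)" using sb sub by blast
  have f_sums: "(\<lambda>m. b m * z ^ m) sums f z" if "norm z < \<rho>" for z
    unfolding f_def using powser_inside[OF sz1] that nz1 by (simp add: summable_sums)
  have holf: "f holomorphic_on ball 0 \<rho>"
    by (rule power_series_holomorphic[where a = b]) (use f_sums in simp)
  have Uball: "U 1 \<subseteq> ball 0 \<rho>"
  proof
    fix x assume "x \<in> U 1"
    then obtain t w where x: "x = t *\<^sub>R w" "0 < t" "t < 1" "w \<in> ball c' r'" by (auto simp: U_def)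
    have "norm w < \<rho>" using x(4) norm_triangle_ineq2[of w c'] by (simp add: \<rho>_def dist_norm norm_minus_commute)
    moreover have "norm x \<le> norm w" using x by (simp add: mult_left_le_one_le)
    ultimately show "x \<in> ball 0 \<rho>" by simp
  qed
  have connU: "connected (U 1)"
  proof -
    have "U 1 = (\<lambda>p. fst p *\<^sub>R snd p) ` ({0<..<1} \<times> ball c' r')"
      unfolding U_def by force
    moreover have "connected ((\<lambda>p. fst p *\<^sub>R snd p) ` ({0<..<1::real} \<times> ball c' r'))"
      by (intro connected_continuous_image continuous_intros connected_Times) auto
    ultimately show ?thesis by simp
  qed
  have T_eq: "f z - (\<Sum>n<n0. u n z) = T z" if "z \<in> U 1" for z
  proof (rule analytic_continuation_open[of "U 1 \<inter> ball c' r'" "U 1"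
        "\<lambda>z. f z - (\<Sum>n<n0. u n z)" T])
    show "U 1 \<inter> ball c' r' \<noteq> {}"
    proof -
      \<comment> \<open>With this t the point t c' has distance r' t < r' from the centre, so it
        lies in both the cone and the disc.\<close>
      define t where "t = norm c' / \<rho>"
      have t: "0 < t" "t < 1" using c0 r' by (auto simp: t_def \<rho>_def add_pos_pos)
      have "dist c' (t *\<^sub>R c') = (1 - t) * norm c'"
        using t norm_scaleR[of "1 - t" c'] by (simp add: dist_norm scaleR_left_diff_distrib)
      also have "1 - t = r' / \<rho>"
        using c0 r' by (simp add: t_def \<rho>_def diff_divide_eq_iff eq_divide_eq add_pos_pos add_nonneg_eq_0_iff)
      also have "r' / \<rho> * norm c' = r' * t" by (simp add: t_def)
      also have "\<dots> < r'" using t r' by simp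
      finally have "t *\<^sub>R c' \<in> ball c' r'" by simp
      moreover have "t *\<^sub>R c' \<in> U 1" unfolding U_def using t r' by (intro UN_I[of t] imageI) auto
      ultimately show ?thesis by blast
    qed
    show "(\<lambda>z. f z - (\<Sum>n<n0. u n z)) holomorphic_on U 1"
      by (intro holomorphic_intros holu holomorphic_on_subset[OF holf Uball])
    fix z assume "z \<in> U 1 \<inter> ball c' r'"
    then have "z \<in> cball c r" using sub ball_subset_cball by blast
    from sA[OF this] have "(\<lambda>n. u n z) sums f z" by (simp add: u_def f_def)
    from sums_split_initial_segment[OF this, of n0]
    show "f z - (\<Sum>n<n0. u n z) = T z" unfolding T_def by (simp add: sums_iff)
  qed (use openU connU holT that in auto)
  \<comment> \<open>N > s puts every term contributing to z^s into the finite part, and \<kappa> N >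
    s makes the tail o(t^s).\<close>
  obtain N where N: "N \<ge> n0" "N > s" "\<kappa> * N > s"
  proof -
    obtain k :: nat where "s / \<kappa> < k" using reals_Archimedean2 by blast
    then have k: "\<kappa> * k > s" using \<kappa> by (simp add: pos_divide_less_eq mult.commute)
    have "\<kappa> * k \<le> \<kappa> * max k (max n0 (Suc s))" using \<kappa> by (intro mult_left_mono) auto
    then have "\<kappa> * max k (max n0 (Suc s)) > s" using k by linarith
    then show ?thesis by (intro that[of "max k (max n0 (Suc s))"]) auto
  qed
  \<comment> \<open>Taylor coefficients of f minus its first N terms. On the cone this difference is
    the tail of the series.\<close>
  define d where "d = (\<lambda>j. b j - (\<Sum>n<N. A n * kapteyn_coeff \<nu> n j))"
  \<comment> \<open>For t < 1/2 the ratio t^\<kappa> is at most q, so the constant in the tail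
    estimate does not depend on t.\<close>
  define q where "q = (1/2::real) powr \<kappa>"
  have q: "0 < q" "q < 1" using \<kappa> powr_less_mono2[of \<kappa> "1/2" 1] by (auto simp: q_def)
  have "d s = 0"
  proof (rule powser_coeff_eq_0_of_ray_decay[OF c0, where \<delta> = "1/2" and p = "\<kappa> * N" and B = "M * (1 / (1 - q))"
        and h = "\<lambda>t. f (of_real t * c') - (\<Sum>n<N. u n (of_real t * c'))"])
    fix t :: real assume t: "0 < t" "t < 1/2"
    define z where "z = of_real t * c'"
    have zU: "z \<in> U 1"
      unfolding U_def z_def scaleR_conv_of_real[symmetric] using t r' by (intro UN_I[of t] imageI) auto
    then have "norm z < \<rho>" using Uball by auto
    from sums_diff[OF f_sums[OF this] sums_sum[of "{..<N}", OF sums_mult[OF kapteyn_term_sums]]]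
    have "(\<lambda>j. d j * z ^ j) sums (f z - (\<Sum>n<N. A n * kapteyn_term \<nu> n z))"
      by (simp add: d_def left_diff_distrib sum_distrib_right mult.assoc)
    then show "(\<lambda>j. d j * (of_real t * c') ^ j) sums (f (of_real t * c') - (\<Sum>n<N. u n (of_real t * c')))"
      by (simp add: z_def u_def)
    have bd: "norm (u (n + N) z) \<le> M * t powr (\<kappa> * N) * q ^ n" for n
    proof -
      have "norm (u (n + N) z) \<le> M * (t powr \<kappa>) ^ (n + N)"
        unfolding z_def using bound[of "n + N" c' t t] t N r' by auto
      also have "\<dots> = M * t powr (\<kappa> * N) * (t powr \<kappa>) ^ n"
        using t by (simp add: power_add powr_powr[symmetric] powr_realpow)
      also have "\<dots> \<le> M * t powr (\<kappa> * N) * q ^ n"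
        unfolding q_def using t \<kappa> M0 by (intro mult_left_mono power_mono powr_mono2) auto
      finally show ?thesis .
    qed
    have sq: "summable (\<lambda>n. M * t powr (\<kappa> * N) * q ^ n)" using q by (simp add: summable_mult summable_geometric)
    have "summable (\<lambda>n. u (n + N) z)" by (rule summable_comparison_test'[OF sq bd])
    then have su: "summable (\<lambda>n. u n z)" by (rule iffD1[OF summable_iff_shift])
    have "f z = (\<Sum>n. u n z)"
      using T_eq[OF zU] suminf_split_initial_segment[OF su, of n0] by (simp add: T_def algebra_simps)
    then have "f z - (\<Sum>n<N. u n z) = (\<Sum>n. u (n + N) z)"
      using suminf_split_initial_segment[OF su, of N] by simp
    also have "norm \<dots> \<le> (\<Sum>n. M * t powr (\<kappa> * N) * q ^ n)"
      by (rule norm_suminf_le[OF bd sq])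
    also have "\<dots> = M * t powr (\<kappa> * N) * (1 / (1 - q))"
      using q by (simp add: suminf_mult summable_geometric suminf_geometric)
    finally show "norm (f (of_real t * c') - (\<Sum>n<N. u n (of_real t * c'))) \<le> M * (1 / (1 - q)) * t powr (\<kappa> * N)"
      by (simp add: z_def mult_ac)
  qed (use N in auto)
  then show ?thesis using sum_kapteyn_coeff[OF N(2), of A \<nu>] by (simp add: d_def)
qed

subsection \<open>Orthogonality\<close>

text \<open>For w = 0 = c both sides are 0^j with 0^0 = 1. For w = 0 and c = -j \<noteq> 0 they
  would be 1 and 0, hence the side condition. In the powers (\<mu>/2)^\<mu> base and exponent vanish
  together.\<close>

lemma cpow_add_of_nat_unless_zero:
  assumes "is_log L" "w \<noteq> 0 \<or> c = 0"
  shows "cpow L w (c + of_nat j) = cpow L w c * w ^ j"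
proof (cases "w = 0")
  case True
  then show ?thesis using assms(2) by (cases j) (auto simp: cpow_def simp del: of_nat_Suc)
next
  case False
  then show ?thesis by (rule cpow_add_of_nat[OF assms(1)])
qed

text \<open>A telescoping evaluation: at j = k the binomial coefficient on the right is 0, so the
  full sum vanishes unless N = k. Keeping N - k as a factor on the left avoids a division and lets
  the identity hold for every N.\<close>

lemma kapteyn_orthogonality_partial_sum:
  fixes N :: complex
  assumes "k > 0" "j \<le> k"
  shows "(N - of_nat k) * (\<Sum>m\<le>j. (-1) ^ m * of_nat (k choose m) * (N - 2 * of_nat m)\<^sup>2
            * pochhammer (N - of_nat m - of_nat k + 1) (k - 1) * N ^ (2 * m) * (N - 2 * of_nat k) ^ (2 * (k - m)))
    = (-1) ^ j * of_nat ((k - 1) choose j) * N ^ (2 * j + 2) * (N - 2 * of_nat k) ^ (2 * (k - j))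
            * pochhammer (N - of_nat j - of_nat k) k"
  using assms(2)
proof (induction j)
  case 0
  obtain k' where k: "k = Suc k'" using assms(1) by (cases k) auto
  show ?case
    unfolding k by (simp add: pochhammer_rec power2_eq_square algebra_simps del: of_nat_Suc)
next
  case (Suc j)
  obtain k' where k: "k = Suc k'" using assms(1) by (cases k) auto
  define m where "m = Suc j"
  define D where "D = N - 2 * of_nat k"
  define P where "P = pochhammer (N - of_nat j - of_nat k) k'"
  define x y :: complex where "x = of_nat (k' choose m)" and "y = of_nat (k' choose j)"
  define K J where "K = (of_nat k :: complex)" and "J = (of_nat m :: complex)"
  have P1: "pochhammer (N - of_nat m - of_nat k + 1) (k - 1) = P"
    by (simp add: P_def m_def k algebra_simps)
  have P2: "pochhammer (N - of_nat j - of_nat k) k = P * (N - J)"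
    unfolding k pochhammer_rec' by (simp add: P_def m_def J_def k algebra_simps)
  have P3: "pochhammer (N - of_nat m - of_nat k) k = (N - J - K) * P"
    unfolding k pochhammer_rec by (simp add: P_def m_def J_def K_def k algebra_simps)
  have C: "of_nat (k choose m) = x + y"
    by (simp add: x_def y_def m_def k)
  have rel: "J * x = (K - J) * y"
  proof (cases "j \<le> k'")
    case True
    have "m * (k' choose m) = (k' - j) * (k' choose j)"
      using binomial_absorb_comp[of k' j] binomial_absorption[of j k'] by (simp only: m_def)
    then have "J * x = of_nat (k' - j) * y"
      unfolding J_def x_def y_def by (metis of_nat_mult)
    also have "of_nat (k' - j) = K - J" using True by (simp add: K_def J_def k m_def of_nat_diff)
    finally show ?thesis .
  next
    case False
    then show ?thesis by (simp add: x_def y_def m_def binomial_eq_0)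
  qed
  have K0: "K \<noteq> 0" using assms(1) by (simp add: K_def)
  \<comment> \<open>By Pascal's rule x + y is \<open>k choose m\<close>. After multiplication by K,
    \<open>rel\<close> turns K x and K y into multiples of x + y, and a polynomial identity in N, J,
    K remains.\<close>
  have "K * ((N - K) * (x + y) * (N - 2 * J)\<^sup>2) = K * (x * N\<^sup>2 * (N - J - K) + y * D\<^sup>2 * (N - J))"
  proof -
    have kx: "K * x = (K - J) * (x + y)" "K * y = J * (x + y)"
      using rel by (simp_all add: algebra_simps)
    have "K * (x * N\<^sup>2 * (N - J - K) + y * D\<^sup>2 * (N - J))
      = (K * x) * N\<^sup>2 * (N - J - K) + (K * y) * D\<^sup>2 * (N - J)" by (simp add: algebra_simps)
    also have "\<dots> = (x + y) * ((K - J) * N\<^sup>2 * (N - J - K) + J * D\<^sup>2 * (N - J))"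
      unfolding kx by (simp add: algebra_simps)
    also have "(K - J) * N\<^sup>2 * (N - J - K) + J * D\<^sup>2 * (N - J) = K * (N - K) * (N - 2 * J)\<^sup>2"
      by (simp add: D_def K_def[symmetric] power2_eq_square algebra_simps)
    finally show ?thesis by (simp add: algebra_simps)
  qed
  then have key: "(N - K) * (x + y) * (N - 2 * J)\<^sup>2 = x * N\<^sup>2 * (N - J - K) + y * D\<^sup>2 * (N - J)"
    using K0 by simp
  have D2: "D ^ (2 * (k - j)) = D\<^sup>2 * D ^ (2 * (k - m))"
    using Suc.prems by (simp add: m_def power_add[symmetric] Suc_diff_Suc del: power_Suc flip: mult_Suc_right)
  define t where "t = (\<lambda>m. (-1) ^ m * of_nat (k choose m) * (N - 2 * of_nat m)\<^sup>2
    * pochhammer (N - of_nat m - of_nat k + 1) (k - 1) * N ^ (2 * m) * (N - 2 * of_nat k) ^ (2 * (k - m)))"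
  have tm: "t m = (-1) ^ m * (x + y) * (N - 2 * J)\<^sup>2 * P * N ^ (2 * m) * D ^ (2 * (k - m))"
    unfolding t_def P1 C by (simp add: D_def J_def)
  have "(N - of_nat k) * sum t {..j} = (-1) ^ j * of_nat ((k - 1) choose j) * N ^ (2 * j + 2)
      * (N - 2 * of_nat k) ^ (2 * (k - j)) * pochhammer (N - of_nat j - of_nat k) k"
    using Suc unfolding t_def by simp
  also have "\<dots> = (-1) ^ j * y * N ^ (2 * j + 2) * (D\<^sup>2 * D ^ (2 * (k - m))) * (P * (N - J))"
    unfolding P2 D_def[symmetric] D2 by (simp add: y_def k)
  finally have "(N - of_nat k) * sum t {..Suc j}
     = (-1) ^ j * y * N ^ (2 * j + 2) * (D\<^sup>2 * D ^ (2 * (k - m))) * (P * (N - J))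
     + (N - K) * ((-1) ^ m * (x + y) * (N - 2 * J)\<^sup>2 * P * N ^ (2 * m) * D ^ (2 * (k - m)))"
    unfolding sum.atMost_Suc distrib_left[of _ "sum t {..j}"] unfolding m_def[symmetric] tm K_def by simp
  also have "\<dots> = (-1) ^ m * P * N ^ (2 * m) * D ^ (2 * (k - m)) *
      ((N - K) * (x + y) * (N - 2 * J)\<^sup>2 - y * D\<^sup>2 * (N - J))"
    by (simp add: m_def algebra_simps)
  also have "\<dots> = (-1) ^ m * P * N ^ (2 * m) * D ^ (2 * (k - m)) * (x * N\<^sup>2 * (N - J - K))"
    unfolding key by simp
  also have "\<dots> = (-1) ^ m * x * N ^ (2 * m + 2) * D ^ (2 * (k - m)) * ((N - J - K) * P)"
    by (simp add: power_add power2_eq_square)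
  finally show ?case
    unfolding m_def[symmetric] P3 D_def[symmetric] unfolding t_def D_def by (simp add: k x_def)
qed

lemma Gamma_mult_rGamma: "z \<notin> \<int>\<^sub>\<le>\<^sub>0 \<Longrightarrow> Gamma z * rGamma z = (1::complex)"
  by (simp add: rGamma_inverse_Gamma Gamma_eq_zero_iff)

lemma kapteyn_orthogonality_0:
  assumes L: "is_log L" and N: "\<nu> + of_nat s \<notin> \<int>\<^sub>\<le>\<^sub>0"
  shows "kapteyn_v L \<nu> s 0 * kapteyn_u L \<nu> s 0 = 1"
proof -
  define N where "N = \<nu> + of_nat s"
  have N0: "N \<noteq> 0" "N \<notin> \<int>\<^sub>\<le>\<^sub>0" using N by (auto simp: N_def)
  define l where "l = L (N / 2)"
  have l: "exp l = N / 2" using L N0 by (simp add: is_log_def l_def)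
  have "exp (- (N + 1) * l) * exp (N * l) * exp l = exp (- (N + 1) * l + N * l + l)"
    by (simp only: exp_add)
  also have "- (N + 1) * l + N * l + l = 0" by (simp add: algebra_simps)
  finally have "cpow L (N / 2) (- (N + 1)) * cpow L (N / 2) N * (N / 2) = 1"
    using N0 unfolding l by (simp add: cpow_def l_def[symmetric])
  moreover have "Gamma N * (N * rGamma (N + 1)) = 1"
    using rGamma_plus1[of N] Gamma_mult_rGamma[OF N0(2)] by simp
  moreover have "kapteyn_v L \<nu> s 0 * kapteyn_u L \<nu> s 0
     = (Gamma N * (N * rGamma (N + 1))) * (cpow L (N / 2) (- (N + 1)) * cpow L (N / 2) N * (N / 2))"
    by (simp add: kapteyn_v_def kapteyn_u_def N_def[symmetric] power2_eq_square)
  ultimately show ?thesis by simp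
qed

text \<open>Up to a factor independent of m, the summands are those of
  \<open>kapteyn_orthogonality_partial_sum\<close>: the Gamma quotient is a Pochhammer symbol and
  the complex powers contribute N^(2 m) D^(2 (k - m)).\<close>

lemma kapteyn_orthogonality:
  assumes L: "is_log L" and def: "\<And>m. m \<le> s div 2 \<Longrightarrow> kapteyn_v_defined \<nu> s m"
    and k: "0 < k" "k \<le> s div 2"
  shows "(\<Sum>m\<le>k. kapteyn_v L \<nu> s m * kapteyn_u L \<nu> (s - 2 * m) (k - m)) = 0"
proof -
  define N where "N = \<nu> + of_nat s"
  define D where "D = N - 2 * of_nat k"
  have N0: "N \<noteq> 0" and pole: "N - of_nat m \<notin> \<int>\<^sub>\<le>\<^sub>0" if "m \<le> k" for m
    using def[of m] that k by (auto simp: N_def kapteyn_v_defined_def)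
  have sub: "\<nu> + of_nat (s - 2 * m) = N - 2 * of_nat m" if "m \<le> k" for m
    using that k by (simp add: N_def of_nat_diff)
  have u: "kapteyn_u L \<nu> (s - 2 * m) (k - m) =
     (-1) ^ (k - m) / fact (k - m) * rGamma (N - of_nat m - of_nat k + 1) * cpow L (D / 2) (N - 2 * of_nat m)"
    if "m \<le> k" for m
    unfolding kapteyn_u_def sub[OF that] using that by (simp add: D_def of_nat_diff algebra_simps)
  have v: "kapteyn_v L \<nu> s m = 1 / 2 * ((N - 2 * of_nat m)\<^sup>2 * Gamma (N - of_nat m) / fact m)
       * cpow L (N / 2) (- (N - 2 * of_nat m + 1))" for m
    by (simp add: kapteyn_v_def N_def)
  show ?thesis
  proof (cases "D = 0")
    \<comment> \<open>Here every product vanishes: for m = k the factor (N - 2 k)^2 of v is 0, and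
      otherwise u contains 0 to a nonzero power.\<close>
    case True
    have "kapteyn_v L \<nu> s m * kapteyn_u L \<nu> (s - 2 * m) (k - m) = 0" if "m \<le> k" for m
    proof (cases "m = k")
      case True
      then show ?thesis using \<open>D = 0\<close> by (simp add: v D_def)
    next
      case False
      have "N - 2 * of_nat m = of_nat (2 * (k - m))"
        using \<open>D = 0\<close> that by (simp add: D_def of_nat_diff algebra_simps)
      then have "N - 2 * of_nat m \<noteq> 0" using False that by (simp del: of_nat_mult of_nat_diff)
      then show ?thesis by (simp add: u[OF that] True cpow_def)
    qed
    then show ?thesis by (intro sum.neutral) auto
  next
    case False
    define c where "c = (-1) ^ k / (2 * fact k * 4 ^ k) * cpow L (N / 2) (- (N + 1)) * cpow L (D / 2) D"
    have "kapteyn_v L \<nu> s m * kapteyn_u L \<nu> (s - 2 * m) (k - m)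
       = c * ((-1) ^ m * of_nat (k choose m) * (N - 2 * of_nat m)\<^sup>2
            * pochhammer (N - of_nat m - of_nat k + 1) (k - 1) * N ^ (2 * m) * D ^ (2 * (k - m)))"
      if "m \<le> k" for m
    proof -
      have "cpow L (D / 2) (N - 2 * of_nat m) = cpow L (D / 2) (D + of_nat (2 * (k - m)))"
        using that by (simp add: D_def of_nat_diff algebra_simps)
      then have c1: "cpow L (D / 2) (N - 2 * of_nat m) = cpow L (D / 2) D * (D / 2) ^ (2 * (k - m))"
        using False cpow_add_of_nat_unless_zero[OF L, of "D / 2" D "2 * (k - m)"] by simp
      have "cpow L (N / 2) (- (N - 2 * of_nat m + 1)) = cpow L (N / 2) (- (N + 1) + of_nat (2 * m))"
        by (simp add: algebra_simps)
      then have c2: "cpow L (N / 2) (- (N - 2 * of_nat m + 1)) = cpow L (N / 2) (- (N + 1)) * (N / 2) ^ (2 * m)"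
        using N0[of 0] cpow_add_of_nat_unless_zero[OF L, of "N / 2" "- (N + 1)" "2 * m"] by simp
      have shift: "N - of_nat m - of_nat k + 1 + of_nat (k - 1) = N - of_nat m"
        using k by (simp add: of_nat_diff)
      have GP: "Gamma (N - of_nat m) * rGamma (N - of_nat m - of_nat k + 1)
         = pochhammer (N - of_nat m - of_nat k + 1) (k - 1)"
        using pochhammer_rGamma[of "N - of_nat m - of_nat k + 1" "k - 1", unfolded shift]
          Gamma_mult_rGamma[OF pole[OF that]]
        by (simp add: mult.left_commute)
      have ch: "(of_nat (k choose m) :: complex) = fact k / (fact m * fact (k - m))"
        using that by (rule binomial_fact)
      have sgn: "(-1) ^ (k - m) = (-1) ^ k * (-1 :: complex) ^ m"
        using that by (simp add: minus_one_power_iff)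
      have "2 * m + 2 * (k - m) = 2 * k" using that by simp
      then have p4: "(2::complex) ^ (2 * m) * 2 ^ (2 * (k - m)) = 4 ^ k"
        using power_add[of "2::complex" "2 * m" "2 * (k - m)"] power_mult[of "2::complex" 2 k] by simp
      have gen: "1 / 2 * (q * G / f) * (e * (N / 2) ^ (2 * m)) * (h / g * R * (l * (D / 2) ^ (2 * (k - m))))
         = (G * R) * h * (q * e * l * N ^ (2 * m) * D ^ (2 * (k - m))
             / (2 * (f * g) * (2 ^ (2 * m) * 2 ^ (2 * (k - m)))))"
        for q G f e h g R l :: complex
        by (simp add: power_divide mult_ac)
      show ?thesis
        unfolding u[OF that] v c1 c2 unfolding gen c_def GP sgn p4 ch by (simp add: mult_ac)
    qed
    then have "(\<Sum>m\<le>k. kapteyn_v L \<nu> s m * kapteyn_u L \<nu> (s - 2 * m) (k - m))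
      = c * (\<Sum>m\<le>k. (-1) ^ m * of_nat (k choose m) * (N - 2 * of_nat m)\<^sup>2
            * pochhammer (N - of_nat m - of_nat k + 1) (k - 1) * N ^ (2 * m) * D ^ (2 * (k - m)))"
      by (simp add: sum_distrib_left)
    \<comment> \<open>Since N - k is not a pole of \<Gamma>, the factor on the left of the
      telescoped identity can be cancelled.\<close>
    moreover have "N - of_nat k \<noteq> 0" using pole[of k] by auto
    ultimately show ?thesis
      using kapteyn_orthogonality_partial_sum[OF k(1) order_refl, of N] k(1)
      by (simp add: D_def binomial_eq_0)
  qed
qed

text \<open>Inserting the formula for b gives a sum over m + j \<le> s div 2. Grouping by k = m + j
  puts an orthogonality sum in front of a (s - 2 k), and only k = 0 survives.\<close>

lemma kapteyn_inversion:
  fixes a b :: "nat \<Rightarrow> complex"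
  assumes L: "is_log L" and def: "\<And>m. m \<le> s div 2 \<Longrightarrow> kapteyn_v_defined \<nu> s m"
    and b: "\<And>s. b s = (\<Sum>m\<le>s div 2. kapteyn_u L \<nu> s m * a (s - 2 * m))"
  shows "a s = (\<Sum>m\<le>s div 2. kapteyn_v L \<nu> s m * b (s - 2 * m))"
proof -
  define M where "M = s div 2"
  let ?g = "\<lambda>m j. kapteyn_v L \<nu> s m * (kapteyn_u L \<nu> (s - 2 * m) j * a (s - 2 * m - 2 * j))"
  have "(\<Sum>m\<le>M. kapteyn_v L \<nu> s m * b (s - 2 * m)) = (\<Sum>m\<le>M. \<Sum>j\<le>M - m. ?g m j)"
  proof (rule sum.cong[OF refl])
    fix m assume "m \<in> {..M}"
    then have "(s - 2 * m) div 2 = M - m" by (simp add: M_def)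
    then show "kapteyn_v L \<nu> s m * b (s - 2 * m) = (\<Sum>j\<le>M - m. ?g m j)"
      by (simp add: b[of "s - 2 * m"] sum_distrib_left)
  qed
  also have "\<dots> = (\<Sum>(m, j)\<in>{(m, j). m + j \<le> M}. ?g m j)"
  proof -
    have "{(m, j). m + j \<le> M} = Sigma {..M} (\<lambda>m. {..M - m})" by auto
    then show ?thesis by (simp add: sum.Sigma)
  qed
  also have "\<dots> = (\<Sum>k\<le>M. \<Sum>m\<le>k. ?g m (k - m))"
    by (rule sum.triangle_reindex_eq)
  also have "\<dots> = (\<Sum>k\<le>M. (if k = 0 then 1 else 0) * a (s - 2 * k))"
  proof (rule sum.cong[OF refl])
    fix k assume k: "k \<in> {..M}"
    have "(\<Sum>m\<le>k. ?g m (k - m))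
      = (\<Sum>m\<le>k. kapteyn_v L \<nu> s m * kapteyn_u L \<nu> (s - 2 * m) (k - m)) * a (s - 2 * k)"
      unfolding sum_distrib_right
    proof (rule sum.cong[OF refl])
      fix m assume "m \<in> {..k}"
      then have "s - 2 * m - 2 * (k - m) = s - 2 * k" by simp
      then show "?g m (k - m) = kapteyn_v L \<nu> s m * kapteyn_u L \<nu> (s - 2 * m) (k - m) * a (s - 2 * k)"
        by (simp only: mult.assoc)
    qed
    also have "(\<Sum>m\<le>k. kapteyn_v L \<nu> s m * kapteyn_u L \<nu> (s - 2 * m) (k - m)) = (if k = 0 then 1 else 0)"
    proof (cases "k = 0")
      case True
      have "\<nu> + of_nat s \<notin> \<int>\<^sub>\<le>\<^sub>0" using def[of 0] by (simp add: kapteyn_v_defined_def)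
      then show ?thesis using True kapteyn_orthogonality_0[OF L] by simp
    next
      case False
      then show ?thesis using kapteyn_orthogonality[OF L def] k by (simp add: M_def)
    qed
    finally show "(\<Sum>m\<le>k. ?g m (k - m)) = (if k = 0 then 1 else 0) * a (s - 2 * k)" .
  qed
  also have "\<dots> = (\<Sum>k\<le>M. if k = 0 then a s else 0)" by (intro sum.cong) auto
  also have "\<dots> = a s" by simp
  finally show ?thesis by (simp add: M_def)
qed

section \<open>From the Bessel series to the entire terms, and conclusion\<close>

lemma bessel_J_prod_eq_kapteyn_term:
  assumes L: "is_log L" and z: "z \<noteq> 0"
  shows "bessel_J_prod L (\<nu> + of_nat n) (\<nu> + of_nat n) z
    = cpow L z \<nu> * (cpow L ((\<nu> + of_nat n) / 2) (\<nu> + of_nat n) * kapteyn_term \<nu> n z)"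
proof -
  define \<mu> where "\<mu> = \<nu> + of_nat n"
  define x where "x = - ((\<mu> * z / 2)\<^sup>2)"
  \<comment> \<open>This collects all branch-dependent powers; the summation index k only adds the
    even integer 2 k to their exponents.\<close>
  define c where "c = cpow L z \<nu> * cpow L (\<mu> / 2) \<mu> * z ^ n"
  have "(-1) ^ k / fact k * rGamma (\<mu> + of_nat k + 1)
      * (cpow L (\<mu> / 2) (\<mu> + 2 * of_nat k) * cpow L z (\<mu> + 2 * of_nat k))
    = c * (rGamma (\<mu> + of_nat k + 1) / fact k * x ^ k)" for k
  proof -
    have c1: "cpow L (\<mu> / 2) (\<mu> + 2 * of_nat k) = cpow L (\<mu> / 2) \<mu> * (\<mu> / 2) ^ (2 * k)"
      using cpow_add_of_nat_unless_zero[OF L, of "\<mu> / 2" \<mu> "2 * k"] by simp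
    have "\<mu> + 2 * of_nat k = \<nu> + of_nat (n + 2 * k)" by (simp add: \<mu>_def)
    then have c2: "cpow L z (\<mu> + 2 * of_nat k) = cpow L z \<nu> * (z ^ n * z ^ (2 * k))"
      by (simp only: cpow_add_of_nat[OF L z] power_add)
    have "x = -1 * ((\<mu> / 2)\<^sup>2 * z\<^sup>2)" by (simp add: x_def power_mult_distrib power_divide)
    then have c3: "x ^ k = (-1) ^ k * ((\<mu> / 2) ^ (2 * k) * z ^ (2 * k))"
      by (simp only: power_mult_distrib power_mult)
    show ?thesis unfolding c1 c2 c3 c_def by (simp add: mult_ac)
  qed
  then have "bessel_J_prod L \<mu> \<mu> z = (\<Sum>k. c * (rGamma (\<mu> + of_nat k + 1) / fact k * x ^ k))"
    by (simp only: bessel_J_prod_def bessel_J_series_def)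
  also have "\<dots> = c * hyper01 \<mu> x"
    using sums_mult[OF hyper01_sums, of c] by (rule sums_unique[symmetric])
  finally show ?thesis
    by (simp add: c_def \<mu>_def x_def kapteyn_term_def mult_ac)
qed

text \<open>With \<mu> = \<nu> + s - 2 m, the power (\<mu>/2)^(\<nu> + s) is (\<mu>/2)^\<mu>
  (\<mu>/2)^(2 m). The first factor is the constant split off from J_\<mu>(\<mu> z); the second
  belongs to the Taylor coefficient of z^s.\<close>

lemma kapteyn_u_eq_coeff:
  assumes L: "is_log L" and m: "m \<le> s div 2"
  shows "kapteyn_u L \<nu> s m = cpow L ((\<nu> + of_nat (s - 2 * m)) / 2) (\<nu> + of_nat (s - 2 * m))
    * kapteyn_coeff \<nu> (s - 2 * m) s"
proof -
  define c where "c = \<nu> + of_nat (s - 2 * m)"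
  have c: "\<nu> + of_nat s - 2 * of_nat m = c" "\<nu> + of_nat s = c + of_nat (2 * m)"
    "\<nu> + of_nat s - of_nat m + 1 = c + of_nat m + 1"
    using m by (simp_all add: c_def of_nat_diff)
  have d: "kapteyn_coeff \<nu> (s - 2 * m) s = rGamma (c + of_nat m + 1) / fact m * (- ((c / 2)\<^sup>2)) ^ m"
  proof -
    have "s - (s - 2 * m) = 2 * m" using m by simp
    then show ?thesis by (simp add: kapteyn_coeff_def c_def)
  qed
  have "- ((c / 2)\<^sup>2) = -1 * (c / 2)\<^sup>2" by simp
  then have p: "(- ((c / 2)\<^sup>2)) ^ m = (-1) ^ m * (c / 2) ^ (2 * m)"
    by (simp only: power_mult_distrib power_mult)
  have q: "cpow L (c / 2) (c + of_nat (2 * m)) = cpow L (c / 2) c * (c / 2) ^ (2 * m)"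
    using cpow_add_of_nat_unless_zero[OF L, of "c / 2" c "2 * m"] by simp
  show ?thesis
    unfolding kapteyn_u_def c_def[symmetric] c(1,3) d p unfolding c(2) q by (simp add: mult_ac)
qed

theorem theorem1:
  fixes \<nu> :: complex and a b :: "nat \<Rightarrow> complex" and f :: "complex \<Rightarrow> complex"
    and \<Omega> :: "complex set" and L :: "complex \<Rightarrow> complex"
  assumes "is_log L"
    and "open \<Omega>" and "connected \<Omega>" and "\<Omega> \<noteq> {}"
    and "\<And>z. z \<in> \<Omega> \<Longrightarrow> summable (\<lambda>m. norm (b m * z ^ m))"
    and "\<And>z. z \<in> \<Omega> \<Longrightarrow> f z = (\<Sum>m. b m * z ^ m)"
    and "\<And>z. z \<in> \<Omega> \<Longrightarrow> z \<noteq> 0 \<Longrightarrow>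
           summable (\<lambda>n. norm (a n * bessel_J_prod L (\<nu> + of_nat n) (\<nu> + of_nat n) z))"
    and "\<And>z. z \<in> \<Omega> \<Longrightarrow> z \<noteq> 0 \<Longrightarrow>
           cpow L z \<nu> * f z = (\<Sum>n. a n * bessel_J_prod L (\<nu> + of_nat n) (\<nu> + of_nat n) z)"
  shows "\<forall>s. ((\<forall>m\<le>s div 2. kapteyn_v_defined \<nu> s m) \<longrightarrow>
               a s = (\<Sum>m\<le>s div 2. kapteyn_v L \<nu> s m * b (s - 2 * m)))
           \<and> b s = (\<Sum>m\<le>s div 2. kapteyn_u L \<nu> s m * a (s - 2 * m))"
proof -
  note L = assms(1)
  obtain c r where r: "r > 0" and sub: "cball c r \<subseteq> \<Omega> \<inter> {z. Im z \<noteq> 0}"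
  proof -
    obtain z where z: "z \<in> \<Omega>" using assms(4) by blast
    then obtain e where e: "e > 0" "ball z e \<subseteq> \<Omega>" using assms(2) open_contains_ball by blast
    \<comment> \<open>A real z is moved up by e/2: the decay estimate needs a disc off the real
      axis, which also keeps 0 out.\<close>
    define w where "w = (if Im z = 0 then z + of_real (e / 2) * \<i> else z)"
    have "w \<in> ball z e" "Im w \<noteq> 0" using e(1) by (auto simp: w_def dist_norm norm_mult)
    then have "w \<in> \<Omega> \<inter> {z. Im z \<noteq> 0}" using e by blast
    moreover have "open (\<Omega> \<inter> {z. Im z \<noteq> 0})"
      by (intro open_Int assms(2) open_Collect_neq continuous_intros)
    ultimately show ?thesis using that open_contains_cball by blast
  qed
  \<comment> \<open>Absorbs the constants (\<mu>/2)^\<mu>; after cancelling z^\<nu>, which is a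
    nonzero exponential, the series runs over the entire terms.\<close>
  define A where "A = (\<lambda>n. a n * cpow L ((\<nu> + of_nat n) / 2) (\<nu> + of_nat n))"
  have b: "b s = (\<Sum>m\<le>s div 2. kapteyn_u L \<nu> s m * a (s - 2 * m))" for s
  proof -
    have "b s = (\<Sum>m\<le>s div 2. A (s - 2 * m) * kapteyn_coeff \<nu> (s - 2 * m) s)"
    proof (rule kapteyn_series_coeffs[OF r])
      fix z assume "z \<in> cball c r"
      then have z: "z \<in> \<Omega>" "Im z \<noteq> 0" using sub by auto
      then have z0: "z \<noteq> 0" by auto
      then have p0: "cpow L z \<nu> \<noteq> 0" by (simp add: cpow_def)
      show "Im z \<noteq> 0" by fact
      show "summable (\<lambda>m. b m * z ^ m)" using assms(5)[OF z(1)] by (rule summable_norm_cancel)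
      have eq: "a n * bessel_J_prod L (\<nu> + of_nat n) (\<nu> + of_nat n) z
          = cpow L z \<nu> * (A n * kapteyn_term \<nu> n z)" for n
        unfolding bessel_J_prod_eq_kapteyn_term[OF L z0] A_def by (simp only: mult_ac)
      have "(\<lambda>n. cpow L z \<nu> * (A n * kapteyn_term \<nu> n z)) sums (cpow L z \<nu> * f z)"
        using summable_sums[OF summable_norm_cancel[OF assms(7)[OF z(1) z0]]] assms(8)[OF z(1) z0]
        unfolding eq by simp
      then show "(\<lambda>n. A n * kapteyn_term \<nu> n z) sums (\<Sum>m. b m * z ^ m)"
        using sums_mult_iff[OF p0] assms(6)[OF z(1)] by simp
    qed
    also have "\<dots> = (\<Sum>m\<le>s div 2. kapteyn_u L \<nu> s m * a (s - 2 * m))"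
      by (intro sum.cong refl) (simp add: kapteyn_u_eq_coeff[OF L] A_def)
    finally show ?thesis .
  qed
  show ?thesis
    using kapteyn_inversion[OF L _ b] b by blast
qed

end
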